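(* Let $H_L$ be the LTI system $\dot x(t)=Ax(t)+Bu(t)$, $x(0)=0$, $y(t)=Cx(t)+Du(t)$, with $x(t)\in\mathbb{R}^m$, $u(t),y(t)\in\mathbb{R}^n$. Assume that $H_L$ is normal, that $A$ is Hurwitz, and that the pair $(A,B)$ is controllable. For $\sigma\in\{-1,+1\}$, $\lambda_c\in\mathbb{R}$, $r>0$ and $P\in\mathbb{S}^m$ let $$\Pi(\sigma,\lambda_c,r)=\sigma\begin{bmatrix}1&-\lambda_c\\-\lambda_c&\lambda_c^2-r^2\end{bmatrix},$$ $$F(\sigma,\lambda_c,r,P)=\begin{bmatrix} A & B\\ I & 0\end{bmatrix}^\top\begin{bmatrix}0&P\\P&0\end{bmatrix}\begin{bmatrix} A & B\\ I & 0\end{bmatrix}-\begin{bmatrix} C & D\\ 0 & I\end{bmatrix}^\top(\Pi(\sigma,\lambda_c,r)\otimes I_n)\begin{bmatrix} C & D\\ 0 & I\end{bmatrix}.$$ Define $$\mathbf{\Pi}_1(H_L)=\{\Pi(-1,\lambda_c,r)\mid \lambda_c\in\mathbb{R},\ r>0,\ \exists P\in\mathbb{S}^m:\ F(-1,\lambda_c,r,P)\preceq0\},$$ $$\mathbf{\Pi}_2(H_L)=\{\Pi(+1,\lambda_c,r)\mid \lambda_c\in\mathbb{R},\ r>0,\ \exists P\in\mathbb{S}^m:\ F(+1,\lambda_c,r,P)\preceq0\}.$$ Then $$\overline{\mathrm{SG}}(H_L)=\bigcap_{\Pi\in\mathbf{\Pi}_1(H_L)\cup\mathbf{\Pi}_2(H_L)}\mathcal{S}(\Pi),$$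 where $\overline{\mathrm{SG}}(H_L)$ is the closure of $\mathrm{SG}(H_L)$ in $\mathbb{C}$.
   Context: $\mathbb{S}^k$ is the set of real symmetric $k\times k$ matrices; $\preceq0$ means negative semidefinite; $\otimes$ is the Kronecker product. A real square matrix is Hurwitz if all its eigenvalues have strictly negative real part. $\mathcal{L}_2^n$ is the space of square-integrable functions $u:\mathbb{R}_{\ge0}\to\mathbb{R}^n$ with $\langle u,y\rangle=\int_0^\infty u(t)^\top y(t)\,dt$ and $\|u\|=\sqrt{\langle u,u\rangle}$. Standing assumption in the paper: the realization $(A,B,C,D)$ is minimal. The transfer function matrix is $H_L(s)=C(sI-A)^{-1}B+D$; the system is called normal if $H_L(s)^*H_L(s)=H_L(s)H_L(s)^*$ for all $s\in\mathbb{C}$ (where $H_L(s)$ is defined), with $*$ the conjugate transpose. Scaled graph: for $u\neq0$ and $y=H_L(u)$, put $\rho(u,y)=\|y\|/\|u\|$ and $\theta(u,y)=\arccos\frac{\langle u,y\rangle}{\|u\|\|y\|}\in[0,\pi]$ if $y\ne0$, $\theta(u,y)=0$ if $y=0$. Then $$\mathrm{SG}(H_L)=\{\rho(u,y)e^{\pm j\theta(u,y)}\mid u\in\mathcal{L}_2^n\setminus\{0\},\ y=H_L(u)\}\subset\mathbb{C}$$ (both signs are included). For $\Pi\in\mathbb{S}^2$, $\mathcal{S}(\Pi)=\left\{z\in\mathbb{C}\;\middle|\;\begin{bmatrix}z\\1\end{bmatrix}^*\Pi\begin{bmatrix}z\\1\end{bmatrix}\ge0\right\}$. (In the paper, $\mathbf{\Pi}_1$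 and $\mathbf{\Pi}_2$ collect the matrices $\Pi$ resulting from all feasible solutions, over all $\lambda_c\in\mathbb{R}$, of the problems of minimizing $r^2$ subject to $F(-1,\lambda_c,r,P)\preceq0$, respectively maximizing $r^2$ subject to $F(+1,\lambda_c,r,P)\preceq0$, with $r>0$ and $P$ symmetric.) *)

theory Defs
  imports "HOL-Analysis.Analysis"
begin

definition in_L2 :: "(real \<Rightarrow> real^'n) \<Rightarrow> bool" where
  "in_L2 u \<longleftrightarrow> u \<in> borel_measurable (lebesgue_on {0..}) \<and>
     integrable (lebesgue_on {0..}) (\<lambda>t. (norm (u t))\<^sup>2)"

text \<open>Signals are represented by functions rather than by classes modulo null sets, so being
  the zero element means vanishing almost everywhere. Values at negative times are irrelevant.\<close>

definition L2_null :: "(real \<Rightarrow> real^'n) \<Rightarrow> bool" where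
  "L2_null u \<longleftrightarrow> (AE t in lebesgue_on {0..}. u t = 0)"

definition L2_inner :: "(real \<Rightarrow> real^'n) \<Rightarrow> (real \<Rightarrow> real^'n) \<Rightarrow> real" where
  "L2_inner u y = (LINT t|lebesgue_on {0..}. u t \<bullet> y t)"

definition L2_norm :: "(real \<Rightarrow> real^'n) \<Rightarrow> real" where
  "L2_norm u = sqrt (L2_inner u u)"

definition sg_gain :: "(real \<Rightarrow> real^'n) \<Rightarrow> (real \<Rightarrow> real^'n) \<Rightarrow> real" where
  "sg_gain u y = L2_norm y / L2_norm u"

definition sg_phase :: "(real \<Rightarrow> real^'n) \<Rightarrow> (real \<Rightarrow> real^'n) \<Rightarrow> real" where
  "sg_phase u y = (if L2_null y then 0 else arccos (L2_inner u y / (L2_norm u * L2_norm y)))"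

text \<open>A system is given by its input-output relation, and viewed as an operator on the space of
  square-integrable signals; hence both signals are required to lie in that space.\<close>

definition scaled_graph :: "((real \<Rightarrow> real^'n) \<Rightarrow> (real \<Rightarrow> real^'n) \<Rightarrow> bool) \<Rightarrow> complex set" where
  "scaled_graph H =
     {of_real (sg_gain u y) * exp (\<i> * of_real (s * sg_phase u y)) | u y s.
        in_L2 u \<and> \<not> L2_null u \<and> in_L2 y \<and> H u y \<and> s \<in> {1, -1}}"

text \<open>Solutions of $\dot x = Ax + Bu$, $x(0) = x_0$ for inputs that are merely square integrable
  are meant in the sense of Caratheodory, that is, as solutions of the integral equation. The
  equation at time 0 gives the initial condition.\<close>

definition lti_state ::
  "real^'m^'m \<Rightarrow> real^'n^'m \<Rightarrow> real^'m \<Rightarrow> (real \<Rightarrow> real^'n) \<Rightarrow> (real \<Rightarrow> real^'m) \<Rightarrow> bool" where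
  "lti_state A B x0 u x \<longleftrightarrow>
     (\<forall>t\<ge>0. ((\<lambda>s. A *v x s + B *v u s) has_integral (x t - x0)) {0..t})"

definition lti_response ::
  "real^'m^'m \<Rightarrow> real^'n^'m \<Rightarrow> real^'m^'n \<Rightarrow> real^'n^'n
     \<Rightarrow> (real \<Rightarrow> real^'n) \<Rightarrow> (real \<Rightarrow> real^'n) \<Rightarrow> bool" where
  "lti_response A B C D u y \<longleftrightarrow>
     (\<exists>x. lti_state A B 0 u x \<and> (\<forall>t\<ge>0. y t = C *v x t + D *v u t))"

text \<open>Controllability: every state can be steered to every other state in finite time.
  Observability: for some finite horizon, the initial state is determined by the input and the
  output over that horizon.\<close>

definition controllable :: "real^'m^'m \<Rightarrow> real^'n^'m \<Rightarrow> bool" where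
  "controllable A B \<longleftrightarrow>
     (\<forall>x0 x1. \<exists>T>0. \<exists>u x. in_L2 u \<and> lti_state A B x0 u x \<and> x T = x1)"

definition observable ::
  "real^'m^'m \<Rightarrow> real^'n^'m \<Rightarrow> real^'m^'n \<Rightarrow> real^'n^'n \<Rightarrow> bool" where
  "observable A B C D \<longleftrightarrow>
     (\<exists>T>0. \<forall>x0 x0' u x x'.
        in_L2 u \<and> lti_state A B x0 u x \<and> lti_state A B x0' u x' \<and>
        (\<forall>t\<in>{0..T}. C *v x t + D *v u t = C *v x' t + D *v u t) \<longrightarrow> x0 = x0')"

definition minimal_realization ::
  "real^'m^'m \<Rightarrow> real^'n^'m \<Rightarrow> real^'m^'n \<Rightarrow> real^'n^'n \<Rightarrow> bool" where
  "minimal_realization A B C D \<longleftrightarrow> controllable A B \<and> observable A B C D"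

abbreviation cmat :: "real^'a^'b \<Rightarrow> complex^'a^'b" where
  "cmat \<equiv> map_matrix complex_of_real"

definition adjoint_mat :: "complex^'a^'b \<Rightarrow> complex^'b^'a" where
  "adjoint_mat M = map_matrix cnj (transpose M)"

definition hurwitz :: "real^'m^'m \<Rightarrow> bool" where
  "hurwitz A \<longleftrightarrow> (\<forall>\<mu> v. v \<noteq> 0 \<and> cmat A *v v = \<mu> *s v \<longrightarrow> Re \<mu> < 0)"

definition transfer ::
  "real^'m^'m \<Rightarrow> real^'n^'m \<Rightarrow> real^'m^'n \<Rightarrow> real^'n^'n \<Rightarrow> complex \<Rightarrow> complex^'n^'n" where
  "transfer A B C D s = cmat C ** matrix_inv (mat s - cmat A) ** cmat B + cmat D"

definition normal_system ::
  "real^'m^'m \<Rightarrow> real^'n^'m \<Rightarrow> real^'m^'n \<Rightarrow> real^'n^'n \<Rightarrow> bool" where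
  "normal_system A B C D \<longleftrightarrow>
     (\<forall>s. invertible (mat s - cmat A) \<longrightarrow>
        adjoint_mat (transfer A B C D s) ** transfer A B C D s =
        transfer A B C D s ** adjoint_mat (transfer A B C D s))"

text \<open>Rows and columns of a 2-by-2 block matrix are indexed by sum types.\<close>

definition block_mat ::
  "'a^'c^'r \<Rightarrow> 'a^'d^'r \<Rightarrow> 'a^'c^'s \<Rightarrow> 'a^'d^'s \<Rightarrow> 'a^('c + 'd)^('r + 's)" where
  "block_mat M11 M12 M21 M22 = (\<chi> i j.
     case i of
       Inl r \<Rightarrow> (case j of Inl c \<Rightarrow> M11 $ r $ c | Inr d \<Rightarrow> M12 $ r $ d)
     | Inr s \<Rightarrow> (case j of Inl c \<Rightarrow> M21 $ s $ c | Inr d \<Rightarrow> M22 $ s $ d))"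

text \<open>The Kronecker product with a 2-by-2 left factor, as the block matrix with blocks
  $a_{ij} M$. Indexing it by a sum type makes it compatible with \<^const>\<open>block_mat\<close>.\<close>

definition kron2 :: "real^2^2 \<Rightarrow> real^'c^'r \<Rightarrow> real^('c + 'c)^('r + 'r)" where
  "kron2 K M = block_mat (K$1$1 *\<^sub>R M) (K$1$2 *\<^sub>R M) (K$2$1 *\<^sub>R M) (K$2$2 *\<^sub>R M)"

definition symmetric_mat :: "real^'k^'k \<Rightarrow> bool" where
  "symmetric_mat M \<longleftrightarrow> transpose M = M"

definition neg_semidef :: "real^'k^'k \<Rightarrow> bool" where
  "neg_semidef M \<longleftrightarrow> symmetric_mat M \<and> (\<forall>v. v \<bullet> (M *v v) \<le> 0)"

definition Pi_mat :: "real \<Rightarrow> real \<Rightarrow> real \<Rightarrow> real^2^2" where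
  "Pi_mat \<sigma> lc r = \<sigma> *\<^sub>R vector [vector [1, - lc], vector [- lc, lc\<^sup>2 - r\<^sup>2]]"

definition F_mat ::
  "real^'m^'m \<Rightarrow> real^'n^'m \<Rightarrow> real^'m^'n \<Rightarrow> real^'n^'n
     \<Rightarrow> real \<Rightarrow> real \<Rightarrow> real \<Rightarrow> real^'m^'m \<Rightarrow> real^('m + 'n)^('m + 'n)" where
  "F_mat A B C D \<sigma> lc r P =
     transpose (block_mat A B (mat 1) 0) ** block_mat 0 P P 0 ** block_mat A B (mat 1) 0
     - transpose (block_mat C D 0 (mat 1)) ** kron2 (Pi_mat \<sigma> lc r) (mat 1 :: real^'n^'n)
         ** block_mat C D 0 (mat 1)"

definition Pi_set1 ::
  "real^'m^'m \<Rightarrow> real^'n^'m \<Rightarrow> real^'m^'n \<Rightarrow> real^'n^'n \<Rightarrow> (real^2^2) set" where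
  "Pi_set1 A B C D = {Pi_mat (-1) lc r | lc r.
     r > 0 \<and> (\<exists>P. symmetric_mat P \<and> neg_semidef (F_mat A B C D (-1) lc r P))}"

definition Pi_set2 ::
  "real^'m^'m \<Rightarrow> real^'n^'m \<Rightarrow> real^'m^'n \<Rightarrow> real^'n^'n \<Rightarrow> (real^2^2) set" where
  "Pi_set2 A B C D = {Pi_mat 1 lc r | lc r.
     r > 0 \<and> (\<exists>P. symmetric_mat P \<and> neg_semidef (F_mat A B C D 1 lc r P))}"

text \<open>For symmetric \<open>Q\<close> the Hermitian form below is real, so taking its real part
  loses nothing.\<close>

definition S_region :: "real^2^2 \<Rightarrow> complex set" where
  "S_region Q = {z. let v = (vector [z, 1] :: complex^2) in
     0 \<le> Re (\<Sum>i\<in>UNIV. \<Sum>j\<in>UNIV. cnj (v $ i) * of_real (Q $ i $ j) * v $ j)}"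

end

theory Submission
  imports Defs "HOL-Computational_Algebra.Fundamental_Theorem_Algebra"
begin

text \<open>
  Membership in the scaled graph only depends on the Gram data \<open>(\<langle>u,u\<rangle>, \<langle>y,y\<rangle>, \<langle>u,y\<rangle>)\<close> of the
  input-output pairs. By time invariance the closure of the set of Gram data is a convex cone, so a
  point outside the closed scaled graph is cut off by a plane, that is, by a circle centred on the
  real axis: all pairs satisfy \<open>\<sigma> (\<parallel>y - \<lambda>u\<parallel>\<^sup>2 - r\<^sup>2 \<parallel>u\<parallel>\<^sup>2) \<ge> 0\<close> and the point violates this. The
  optimal value of the integral of this supply, as a function of the initial state, is a quadratic
  form which solves the linear matrix inequality. Conversely, a solution of the inequality gives a
  quadratic storage function; it is integrated along trajectories, which are square integrable
  because the state matrix is Hurwitz.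
\<close>

text \<open>Inputs are merely square integrable, so states are differentiable only in the integrated
  sense, and every energy identity goes through \<open>has_integral_inner_by_parts\<close>. Square
  integrability of states comes from an annihilating polynomial of the state matrix, whose stable
  linear factors are peeled off one at a time by an energy estimate. The storage function may be
  indefinite, so its final value cannot be dropped. It is made negligible at a late time at which
  the state happens to be small; no limit of the state is required. A sum of Gram data is reached
  only in the limit of infinite delay, which is why the cone has to be closed before it is convex. A
  separating plane need not come from a circle of positive radius: it may describe a half-plane, or
  a disk whose squared radius is not positive. Strictness of the separation leaves room to repair
  both cases. The separated inequality speaks of trajectories from rest; reaching every state from
  rest turns it into a lower bound for all initial states. The infimum need not be attained, so its
  quadratic form is found through the parallelogram law and not from a minimiser.\<close>

section \<open>Square-integrable signals\<close>

text \<open>On a partition so fine that \<open>h\<close> grows by less than \<open>e\<close> on each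
  piece, the squares of the increments add up to at most \<open>e\<close> times the total growth of
  \<open>h\<close>, and \<open>e\<close> is arbitrary.\<close>

lemma eq_of_quadratic_increment:
  fixes D h :: "real \<Rightarrow> real"
  assumes T: "0 \<le> T" and h: "continuous_on {0..T} h"
    and mono: "\<And>a b. 0 \<le> a \<Longrightarrow> a \<le> b \<Longrightarrow> b \<le> T \<Longrightarrow> h a \<le> h b"
    and D: "\<And>a b. 0 \<le> a \<Longrightarrow> a \<le> b \<Longrightarrow> b \<le> T \<Longrightarrow> \<bar>D b - D a\<bar> \<le> (h b - h a)\<^sup>2"
  shows "D T = D 0"
proof -
  have est: "\<bar>D T - D 0\<bar> \<le> e * (h T - h 0)" if e: "e > 0" for e
  proof -
    have "uniformly_continuous_on {0..T} h"
      using h by (simp add: compact_uniformly_continuous)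
    then obtain d where d: "d > 0"
      and hd: "\<And>x y. x \<in> {0..T} \<Longrightarrow> y \<in> {0..T} \<Longrightarrow> dist y x < d \<Longrightarrow> dist (h y) (h x) < e"
      using e unfolding uniformly_continuous_on_def by metis
    obtain n :: nat where n: "T / d < real n"
      using reals_Archimedean2 by blast
    have n0: "n > 0"
      using n T d by (cases n) (auto simp: field_simps)
    define t where "t i = real i * (T / real n)" for i
    have step: "0 \<le> t i" "t i \<le> t (Suc i)" "t (Suc i) \<le> T" "t (Suc i) - t i < d" if "i < n" for i
    proof -
      show "0 \<le> t i" "t i \<le> t (Suc i)"
        using T n0 by (auto simp: t_def field_simps)
      have "real (Suc i) * T \<le> real n * T"
        using that T by (intro mult_right_mono) auto
      then show "t (Suc i) \<le> T"
        using n0 by (simp add: t_def field_simps)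
      show "t (Suc i) - t i < d"
        using n n0 d by (simp add: t_def field_simps)
    qed
    have "\<bar>D T - D 0\<bar> = \<bar>\<Sum>i<n. D (t (Suc i)) - D (t i)\<bar>"
      using n0 by (subst sum_lessThan_telescope) (simp add: t_def)
    also have "\<dots> \<le> (\<Sum>i<n. \<bar>D (t (Suc i)) - D (t i)\<bar>)"
      by (rule sum_abs)
    also have "\<dots> \<le> (\<Sum>i<n. e * (h (t (Suc i)) - h (t i)))"
    proof (rule sum_mono)
      fix i assume "i \<in> {..<n}"
      then have i: "i < n" by simp
      note s = step[OF i]
      have m: "0 \<le> h (t (Suc i)) - h (t i)"
        using mono s by simp
      have "dist (h (t (Suc i))) (h (t i)) < e"
        using s by (intro hd) (auto simp: dist_real_def)
      then have "h (t (Suc i)) - h (t i) \<le> e"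
        by (simp add: dist_real_def)
      then have "(h (t (Suc i)) - h (t i))\<^sup>2 \<le> e * (h (t (Suc i)) - h (t i))"
        unfolding power2_eq_square using m by (intro mult_right_mono)
      then show "\<bar>D (t (Suc i)) - D (t i)\<bar> \<le> e * (h (t (Suc i)) - h (t i))"
        using D s by (meson order_trans)
    qed
    also have "\<dots> = e * (h T - h 0)"
      using n0 by (subst sum_distrib_left[symmetric], subst sum_lessThan_telescope) (simp add: t_def)
    finally show ?thesis .
  qed
  have m: "0 \<le> h T - h 0"
    using mono T by simp
  have "\<bar>D T - D 0\<bar> \<le> 0 + e" if "e > 0" for e
  proof -
    \<comment> \<open>The added 1 keeps the denominator positive when \<open>h\<close> is
      constant.\<close>
    have "\<bar>D T - D 0\<bar> \<le> e / (h T - h 0 + 1) * (h T - h 0)"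
      using est[of "e / (h T - h 0 + 1)"] that m by simp
    also have "\<dots> \<le> e"
      using m that by (simp add: field_simps)
    finally show ?thesis by simp
  qed
  then have "\<bar>D T - D 0\<bar> \<le> 0"
    by (rule field_le_epsilon)
  then show ?thesis by simp
qed

text \<open>Here \<open>f'\<close> and \<open>g'\<close> are derivatives only in the integrated sense, so the usual integration by
  parts does not apply. The error over \<open>[a, b]\<close> is at most the square of
  \<open>\<integral>\<^sub>a\<^sup>b (\<bar>f'\<bar> + \<bar>g'\<bar>)\<close>, and such errors add up to nothing.\<close>

lemma has_integral_inner_by_parts:
  fixes f g f' g' :: "real \<Rightarrow> 'a::euclidean_space"
  assumes T: "0 \<le> T"
    and f': "f' absolutely_integrable_on {0..T}" and g': "g' absolutely_integrable_on {0..T}"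
    and f: "\<And>t. 0 \<le> t \<Longrightarrow> t \<le> T \<Longrightarrow> (f' has_integral (f t - f 0)) {0..t}"
    and g: "\<And>t. 0 \<le> t \<Longrightarrow> t \<le> T \<Longrightarrow> (g' has_integral (g t - g 0)) {0..t}"
  shows "((\<lambda>t. f t \<bullet> g' t + f' t \<bullet> g t) has_integral (f T \<bullet> g T - f 0 \<bullet> g 0)) {0..T}"
proof -
  have cont: "continuous_on {0..T} F"
    if F': "F' absolutely_integrable_on {0..T}"
      and F: "\<And>t. 0 \<le> t \<Longrightarrow> t \<le> T \<Longrightarrow> (F' has_integral (F t - F 0)) {0..t}"
    for F F' :: "real \<Rightarrow> 'a"
  proof -
    have "continuous_on {0..T} (\<lambda>t. F 0 + integral {0..t} F')"
      using F' by (intro continuous_intros indefinite_integral_continuous_1)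
        (auto simp: absolutely_integrable_on_def)
    moreover have "F t = F 0 + integral {0..t} F'" if "t \<in> {0..T}" for t
      using integral_unique[OF F[of t]] that by simp
    ultimately show ?thesis
      by (metis (no_types, lifting) continuous_on_eq)
  qed
  have cf: "continuous_on {0..T} f" and cg: "continuous_on {0..T} g"
    using cont f f' g g' by blast+
  have meas: "F \<in> borel_measurable (lebesgue_on {0..T})" "bounded (F ` {0..T})"
    if "continuous_on {0..T} F" for F :: "real \<Rightarrow> 'a"
    using that by (auto intro!: continuous_imp_measurable_on_sets_lebesgue compact_imp_bounded
        compact_continuous_image)
  have bil: "bilinear (\<lambda>x y. x \<bullet> (y::'a))"
    using bilinear_conv_bounded_bilinear bounded_bilinear_inner by blast
  have prod: "(\<lambda>t. F t \<bullet> F' t) absolutely_integrable_on {0..T}"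
    if "continuous_on {0..T} F" "F' absolutely_integrable_on {0..T}" for F F' :: "real \<Rightarrow> 'a"
    using absolutely_integrable_bounded_measurable_product[OF bil meas(1)[OF that(1)] _ meas(2)[OF that(1)] that(2)]
    by simp
  define k where "k t = f t \<bullet> g' t + f' t \<bullet> g t" for t
  have k_abs: "k absolutely_integrable_on {0..T}"
    unfolding k_def using prod[OF cf g'] prod[OF cg f']
    by (auto simp: inner_commute intro!: set_integral_add)
  define p where "p t = norm (f' t) + norm (g' t)" for t
  have p_int: "p integrable_on {0..T}"
    unfolding p_def using f' g' by (auto simp: absolutely_integrable_on_def intro!: integrable_add)
  have sub: "F integrable_on {a..b}" if "F integrable_on {0..T}" "0 \<le> a" "b \<le> T"
    for a b and F :: "real \<Rightarrow> 'b::euclidean_space"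
    using that by (auto intro: integrable_on_subinterval)
  have comb: "integral {0..b} F - integral {0..a} F = integral {a..b} F"
    if "F integrable_on {0..T}" "0 \<le> a" "a \<le> b" "b \<le> T"
    for a b and F :: "real \<Rightarrow> 'b::euclidean_space"
    using Henstock_Kurzweil_Integration.integral_combine[of 0 a b F] that sub[of F 0 b]
    by (simp add: algebra_simps)
  define h where "h t = integral {0..t} p" for t
  \<comment> \<open>\<open>D\<close> is the defect in the product rule, to be shown constant;
    \<open>h\<close> is the bound on its increments, the accumulated size of both
    derivatives.\<close>
  define D where "D t = f t \<bullet> g t - integral {0..t} k" for t
  have f'i: "f' integrable_on {0..T}" "(\<lambda>t. norm (f' t)) integrable_on {0..T}"
    and g'i: "g' integrable_on {0..T}" "(\<lambda>t. norm (g' t)) integrable_on {0..T}"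
    and ki: "k integrable_on {0..T}"
    using f' g' k_abs by (auto simp: absolutely_integrable_on_def)
  have incf: "(f' has_integral (f b - f a)) {a..b}" "(g' has_integral (g b - g a)) {a..b}"
    if "0 \<le> a" "a \<le> b" "b \<le> T" for a b
  proof -
    have "f b - f a = integral {a..b} f'"
      using comb[OF f'i(1) that] f[of b] f[of a] that by (simp add: integral_unique)
    then show "(f' has_integral (f b - f a)) {a..b}"
      using sub[OF f'i(1)] that by (simp add: integrable_integral)
    have "g b - g a = integral {a..b} g'"
      using comb[OF g'i(1) that] g[of b] g[of a] that by (simp add: integral_unique)
    then show "(g' has_integral (g b - g a)) {a..b}"
      using sub[OF g'i(1)] that by (simp add: integrable_integral)
  qed
  have hdiff: "h b - h a = integral {a..b} p" if "0 \<le> a" "a \<le> b" "b \<le> T" for a b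
    unfolding h_def using comb[OF p_int that] .
  have p0: "0 \<le> p t" for t by (simp add: p_def)
  have small: "norm (f b - f a) \<le> h b' - h a'" "norm (g b - g a) \<le> h b' - h a'"
    if ab: "0 \<le> a'" "a' \<le> a" "a \<le> b" "b \<le> b'" "b' \<le> T" for a b a' b'
  proof -
    have le: "integral {a..b} p \<le> integral {a'..b'} p"
      using ab p0 sub[OF p_int] by (intro integral_subset_le) auto
    have "norm (integral {a..b} f') \<le> integral {a..b} p" "norm (integral {a..b} g') \<le> integral {a..b} p"
      using ab sub[OF p_int] sub[OF f'i(1)] sub[OF g'i(1)]
      by (auto intro!: integral_norm_bound_integral simp: p_def)
    then show "norm (f b - f a) \<le> h b' - h a'" "norm (g b - g a) \<le> h b' - h a'"
      using incf[of a b] ab le hdiff[of a' b'] by (auto simp: integral_unique)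
  qed
  have "D T = D 0"
  proof (rule eq_of_quadratic_increment[OF T, of h])
    show "continuous_on {0..T} h"
      unfolding h_def using p_int by (rule indefinite_integral_continuous_1)
    show "h a \<le> h b" if "0 \<le> a" "a \<le> b" "b \<le> T" for a b
    proof -
      have "0 \<le> integral {a..b} p"
        using that p0 sub[OF p_int] by (intro integral_nonneg) auto
      then show ?thesis using hdiff[OF that] by simp
    qed
    show "\<bar>D b - D a\<bar> \<le> (h b - h a)\<^sup>2" if ab: "0 \<le> a" "a \<le> b" "b \<le> T" for a b
    proof -
      \<comment> \<open>Freezing \<open>f\<close> at the right end and \<open>g\<close> at the left
        end makes the product rule exact over the interval: the integral equals
        \<open>f b \<bullet> g b - f a \<bullet> g a\<close>. What remains is the error of replacing
        \<open>f s\<close> by \<open>f b\<close> and \<open>g s\<close> by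
        \<open>g a\<close>.\<close>
      have 1: "((\<lambda>s. f b \<bullet> g' s + g a \<bullet> f' s) has_integral (f b \<bullet> (g b - g a) + g a \<bullet> (f b - f a))) {a..b}"
        using has_integral_linear[OF incf(2)[OF ab] bounded_linear_inner_right[of "f b"]]
          has_integral_linear[OF incf(1)[OF ab] bounded_linear_inner_right[of "g a"]]
        by (intro has_integral_add) (auto simp: o_def)
      have "((\<lambda>s. (f b \<bullet> g' s + g a \<bullet> f' s) - k s) has_integral
          (f b \<bullet> (g b - g a) + g a \<bullet> (f b - f a) - integral {a..b} k)) {a..b}"
        using 1 sub[OF ki] ab by (intro has_integral_diff) (auto simp: integrable_integral)
      moreover have "f b \<bullet> (g b - g a) + g a \<bullet> (f b - f a) - integral {a..b} k = D b - D a"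
        unfolding D_def using comb[OF ki ab] by (simp add: algebra_simps inner_diff inner_commute)
      ultimately have 2: "((\<lambda>s. (f b \<bullet> g' s + g a \<bullet> f' s) - k s) has_integral (D b - D a)) {a..b}"
        by simp
      have "norm (integral {a..b} (\<lambda>s. (f b \<bullet> g' s + g a \<bullet> f' s) - k s))
          \<le> integral {a..b} (\<lambda>s. (h b - h a) * p s)"
      proof (rule integral_norm_bound_integral)
        show "(\<lambda>s. (f b \<bullet> g' s + g a \<bullet> f' s) - k s) integrable_on {a..b}"
          using 2 by blast
        show "(\<lambda>s. (h b - h a) * p s) integrable_on {a..b}"
          using sub[OF p_int] ab by (intro integrable_on_mult_right) auto
        fix s assume s: "s \<in> {a..b}"
        have "(f b \<bullet> g' s + g a \<bullet> f' s) - k s = (f b - f s) \<bullet> g' s + (g a - g s) \<bullet> f' s"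
          by (simp add: k_def algebra_simps inner_diff inner_commute)
        also have "norm \<dots> \<le> norm (f b - f s) * norm (g' s) + norm (g a - g s) * norm (f' s)"
          by (intro norm_triangle_le add_mono) (auto simp: Cauchy_Schwarz_ineq2)
        also have "\<dots> \<le> (h b - h a) * norm (g' s) + (h b - h a) * norm (f' s)"
        proof (intro add_mono mult_right_mono)
          show "norm (f b - f s) \<le> h b - h a"
            using small(1)[of a s b b] ab s by auto
          show "norm (g a - g s) \<le> h b - h a"
            using small(2)[of a a s b] ab s by (auto simp: norm_minus_commute)
        qed auto
        finally show "norm ((f b \<bullet> g' s + g a \<bullet> f' s) - k s) \<le> (h b - h a) * p s"
          by (simp add: p_def algebra_simps)
      qed
      also have "\<dots> = (h b - h a) * (h b - h a)"
        using hdiff[OF ab] by simp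
      finally show ?thesis
        using 2 by (simp add: integral_unique power2_eq_square)
    qed
  qed
  then have "f T \<bullet> g T - f 0 \<bullet> g 0 = integral {0..T} k"
    by (simp add: D_def)
  then show ?thesis
    using ki unfolding k_def by (simp add: has_integral_integrable_integral)
qed

text \<open>The counterpart of \<open>in_L2\<close> for any Euclidean codomain, since complexified
  states occur too, and with the gauge integral, in which the state equation is stated.\<close>

definition sq_int :: "(real \<Rightarrow> 'a::euclidean_space) \<Rightarrow> bool" where
  "sq_int f \<longleftrightarrow> f \<in> borel_measurable (lebesgue_on {0..}) \<and> (\<lambda>t. (norm (f t))\<^sup>2) integrable_on {0..}"

lemma sq_int_bound:
  fixes f :: "real \<Rightarrow> 'a::euclidean_space"
  assumes "f \<in> borel_measurable (lebesgue_on {0..})" "g integrable_on {0..}"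
    and "\<And>t. t \<ge> 0 \<Longrightarrow> (norm (f t))\<^sup>2 \<le> g t"
  shows "sq_int f"
proof -
  have "(\<lambda>t. (norm (f t))\<^sup>2) absolutely_integrable_on {0..}"
    using assms by (intro measurable_bounded_by_integrable_imp_absolutely_integrable[of _ _ g]) auto
  then show ?thesis
    using assms(1) by (simp add: sq_int_def absolutely_integrable_on_def)
qed

lemma sq_int_inner:
  fixes f g :: "real \<Rightarrow> 'a::euclidean_space"
  assumes "sq_int f" "sq_int g"
  shows "(\<lambda>t. f t \<bullet> g t) absolutely_integrable_on {0..}"
proof (rule measurable_bounded_by_integrable_imp_absolutely_integrable)
  show "(\<lambda>t. f t \<bullet> g t) \<in> borel_measurable (lebesgue_on {0..})"
    using assms by (auto simp: sq_int_def intro!: borel_measurable_inner)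
  show "(\<lambda>t. (norm (f t))\<^sup>2 + (norm (g t))\<^sup>2) integrable_on {0..}"
    using assms by (auto simp: sq_int_def intro!: integrable_add)
  fix t :: real
  have "norm (f t \<bullet> g t) \<le> norm (f t) * norm (g t)"
    by (simp add: Cauchy_Schwarz_ineq2)
  also have "\<dots> \<le> (norm (f t))\<^sup>2 + (norm (g t))\<^sup>2"
    using sum_squares_bound[of "norm (f t)" "norm (g t)"] norm_ge_zero[of "f t"] norm_ge_zero[of "g t"]
      mult_nonneg_nonneg[of "norm (f t)" "norm (g t)"] by linarith
  finally show "norm (f t \<bullet> g t) \<le> (norm (f t))\<^sup>2 + (norm (g t))\<^sup>2" .
qed auto

lemma sq_int_linear:
  assumes "bounded_linear h" "sq_int f"
  shows "sq_int (\<lambda>t. h (f t))"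
proof -
  obtain K where K: "\<And>x. norm (h x) \<le> norm x * K"
    using bounded_linear.bounded[OF assms(1)] by blast
  show ?thesis
  proof (rule sq_int_bound)
    show "(\<lambda>t. h (f t)) \<in> borel_measurable (lebesgue_on {0..})"
      using assms borel_measurable_continuous_onI[OF linear_continuous_on[OF assms(1)]]
      by (auto simp: sq_int_def intro: measurable_compose)
    show "(\<lambda>t. K\<^sup>2 * (norm (f t))\<^sup>2) integrable_on {0..}"
      using assms by (auto simp: sq_int_def intro: integrable_on_mult_right)
    show "(norm (h (f t)))\<^sup>2 \<le> K\<^sup>2 * (norm (f t))\<^sup>2" for t
      using power_mono[OF K[of "f t"] norm_ge_zero, of 2] by (simp add: power_mult_distrib mult.commute)
  qed
qed

lemma sq_int_scaleR: "sq_int f \<Longrightarrow> sq_int (\<lambda>t. c *\<^sub>R f t)"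
  by (rule sq_int_linear) (auto intro: bounded_linear_scaleR_right)

lemma sq_int_add:
  assumes "sq_int f" "sq_int g" shows "sq_int (\<lambda>t. f t + g t)"
proof (rule sq_int_bound)
  show "(\<lambda>t. f t + g t) \<in> borel_measurable (lebesgue_on {0..})"
    using assms by (auto simp: sq_int_def)
  show "(\<lambda>t. 2 * (norm (f t))\<^sup>2 + 2 * (norm (g t))\<^sup>2) integrable_on {0..}"
    using assms by (auto simp: sq_int_def intro!: integrable_add integrable_on_mult_right)
  show "(norm (f t + g t))\<^sup>2 \<le> 2 * (norm (f t))\<^sup>2 + 2 * (norm (g t))\<^sup>2" for t
  proof -
    have "(norm (f t + g t))\<^sup>2 \<le> (norm (f t) + norm (g t))\<^sup>2"
      by (intro power_mono norm_triangle_ineq) auto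
    then show ?thesis
      using sum_squares_bound[of "norm (f t)" "norm (g t)"] by (simp add: power2_sum)
  qed
qed

lemma sq_int_zero [simp]: "sq_int (\<lambda>t. 0)"
  by (simp add: sq_int_def integrable_0)

lemma sq_int_cong:
  assumes "\<And>t. t \<ge> 0 \<Longrightarrow> f t = g t" shows "sq_int f \<longleftrightarrow> sq_int g"
proof -
  have "f \<in> borel_measurable (lebesgue_on {0..}) \<longleftrightarrow> g \<in> borel_measurable (lebesgue_on {0..})"
    using assms by (intro measurable_cong) auto
  moreover have "(\<lambda>t. (norm (f t))\<^sup>2) integrable_on {0..} \<longleftrightarrow> (\<lambda>t. (norm (g t))\<^sup>2) integrable_on {0..}"
    using assms by (intro integrable_cong) auto
  ultimately show ?thesis by (simp add: sq_int_def)
qed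

lemma sq_int_absolutely_integrable:
  assumes "sq_int f" shows "f absolutely_integrable_on {0..T}"
proof (rule measurable_bounded_by_integrable_imp_absolutely_integrable)
  show "f \<in> borel_measurable (lebesgue_on {0..T})"
    using assms unfolding sq_int_def by (auto intro: measurable_restrict_mono)
  have "(\<lambda>t. (norm (f t))\<^sup>2) integrable_on {0..T}"
    using assms unfolding sq_int_def by (auto intro: integrable_on_subinterval)
  then show "(\<lambda>t. 1 + (norm (f t))\<^sup>2) integrable_on {0..T}"
    by (auto intro!: integrable_add)
  show "norm (f t) \<le> 1 + (norm (f t))\<^sup>2" for t
    using sum_squares_bound[of 1 "norm (f t)"] norm_ge_zero[of "f t"] by (simp, linarith)
qed auto

lemma integral_tendsto_at_top:
  fixes f :: "real \<Rightarrow> real"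
  assumes "f absolutely_integrable_on {0..}"
  shows "((\<lambda>T. integral {0..T} f) \<longlongrightarrow> integral {0..} f) at_top"
proof -
  have 1: "((\<lambda>T. LINT t:{0..T}|lebesgue. f t) \<longlongrightarrow> (LINT t:{0..}|lebesgue. f t)) at_top"
    using assms by (intro tendsto_set_lebesgue_integral_at_top) auto
  have 2: "(LINT t:{0..}|lebesgue. f t) = integral {0..} f"
    using assms by (simp add: set_lebesgue_integral_eq_integral)
  have 3: "(LINT t:{0..T}|lebesgue. f t) = integral {0..T} f" for T
    using absolutely_integrable_on_subinterval[OF assms, of 0 T] by (simp add: set_lebesgue_integral_eq_integral)
  show ?thesis using 1 unfolding 2 3 .
qed

text \<open>Monotone convergence along the truncations to \<open>{0..real n}\<close>.\<close>

lemma integrable_on_half_line_bounded: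
  fixes f :: "real \<Rightarrow> real"
  assumes "\<And>t. t \<ge> 0 \<Longrightarrow> 0 \<le> f t" "\<And>T. T \<ge> 0 \<Longrightarrow> f integrable_on {0..T}"
    and "\<And>T. T \<ge> 0 \<Longrightarrow> integral {0..T} f \<le> K"
  shows "f integrable_on {0..}"
proof -
  define g where "g n t = (if t \<in> {0..real n} then f t else 0)" for n :: nat and t
  have gi: "(g n) integrable_on {0..}" "integral {0..} (g n) = integral {0..real n} f" for n
  proof -
    show "(g n) integrable_on {0..}"
      unfolding g_def using assms(2)[of "real n"] by (subst integrable_restrict_Int) (simp add: Int_absorb2)
    show "integral {0..} (g n) = integral {0..real n} f"
      unfolding g_def by (subst integral_restrict_Int) (simp add: Int_absorb2)
  qed
  have "f integrable_on {0..} \<and> (\<lambda>n. integral {0..} (g n)) \<longlonglongrightarrow> integral {0..} f"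
  proof (rule monotone_convergence_increasing)
    show "(g n) integrable_on {0..}" for n by (rule gi)
    show "g n t \<le> g (Suc n) t" if "t \<in> {0..}" for n t
      using assms(1)[of t] that by (auto simp: g_def)
    show "(\<lambda>n. g n t) \<longlonglongrightarrow> f t" if "t \<in> {0..}" for t
    proof (rule tendsto_eventually)
      obtain N :: nat where "t \<le> real N" using real_arch_simple by blast
      then show "\<forall>\<^sub>F n in sequentially. g n t = f t"
        using that by (auto simp: g_def eventually_sequentially intro!: exI[of _ N])
    qed
    have "\<bar>integral {0..real n} f\<bar> \<le> K" for n
      using assms(3)[of "real n"] integral_nonneg[OF assms(2)[of "real n"]] assms(1) by auto
    then show "bounded (range (\<lambda>n. integral {0..} (g n)))"
      unfolding gi by (auto simp: bounded_iff)
  qed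
  then show ?thesis ..
qed

text \<open>If the norm stayed above \<open>e\<close> from some time on, the energy would be
  infinite. This weak form of decay suffices to control a storage function at one late time.\<close>

lemma sq_int_small:
  assumes "sq_int f" "e > 0"
  shows "\<exists>t\<ge>N. norm (f t) < e"
proof (rule ccontr)
  assume "\<not> ?thesis"
  then have ge: "e \<le> norm (f t)" if "t \<ge> N" for t using that by force
  define M where "M = max 0 N"
  have i: "(\<lambda>t. (norm (f t))\<^sup>2) integrable_on {0..}" using assms by (simp add: sq_int_def)
  define I where "I = integral {0..} (\<lambda>t. (norm (f t))\<^sup>2)"
  have I0: "0 \<le> I" unfolding I_def by (rule integral_nonneg[OF i]) simp
  \<comment> \<open>An interval of this length carries energy at least \<open>I + 1\<close>, more
    than the whole.\<close>
  define L where "L = (I + 1) / e\<^sup>2"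
  have L0: "0 \<le> L" using I0 assms by (simp add: L_def)
  have "integral {M..M+L} (\<lambda>t. e\<^sup>2) \<le> integral {0..} (\<lambda>t. (norm (f t))\<^sup>2)"
  proof (rule order_trans)
    have s: "(\<lambda>t. (norm (f t))\<^sup>2) integrable_on {M..M+L}"
      using i by (rule integrable_on_subinterval) (auto simp: M_def)
    show "integral {M..M+L} (\<lambda>t. e\<^sup>2) \<le> integral {M..M+L} (\<lambda>t. (norm (f t))\<^sup>2)"
      using s ge assms by (intro integral_le) (auto simp: M_def intro!: power_mono)
    show "integral {M..M+L} (\<lambda>t. (norm (f t))\<^sup>2) \<le> integral {0..} (\<lambda>t. (norm (f t))\<^sup>2)"
      using s i by (intro integral_subset_le) (auto simp: M_def)
  qed
  then have "L * e\<^sup>2 \<le> I" using L0 by (simp add: I_def)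
  then show False using assms by (simp add: L_def)
qed

section \<open>Stability\<close>

lemma continuous_on_half_line_integral:
  fixes F z :: "real \<Rightarrow> 'a::euclidean_space"
  assumes "\<And>t. t \<ge> 0 \<Longrightarrow> (F has_integral (z t - c)) {0..t}"
  shows "continuous_on {0..} z"
proof -
  have *: "continuous_on {0..T} z" if "T \<ge> 0" for T
  proof -
    have "continuous_on {0..T} (\<lambda>t. c + integral {0..t} F)"
      using assms[OF that] by (intro continuous_intros indefinite_integral_continuous_1) blast
    moreover have "c + integral {0..t} F = z t" if "t \<in> {0..T}" for t
      using integral_unique[OF assms[of t]] that by simp
    ultimately show ?thesis
      by (metis (no_types, lifting) continuous_on_eq)
  qed
  show ?thesis
    unfolding continuous_on_eq_continuous_within
  proof
    fix t :: real assume t: "t \<in> {0..}"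
    have "continuous (at t within {0..t+1}) z"
      using *[of "t+1"] t by (auto simp: continuous_on_eq_continuous_within)
    moreover have "at t within {0..t+1} = at t within {0..}"
      by (rule at_within_nhd[of t "{t-1<..<t+1}"]) auto
    ultimately show "continuous (at t within {0..}) z" by simp
  qed
qed

text \<open>Energy estimate: the derivative of \<open>|z|^2\<close> is at most
  \<open>- 2 a |z|^2 + 2 z \<bullet> f\<close>. Half of the damping absorbs the cross term, the
  other half bounds the energy of \<open>z\<close> on every \<open>{0..T}\<close> by the same
  constant \<open>K\<close>.\<close>

lemma sq_int_decay:
  fixes z f :: "real \<Rightarrow> 'a::euclidean_space"
  assumes L: "linear L" and a: "a > 0" "\<And>v. v \<bullet> L v \<le> - a * (norm v)\<^sup>2"
    and f: "sq_int f"
    and z: "\<And>t. t \<ge> 0 \<Longrightarrow> ((\<lambda>s. L (z s) + f s) has_integral (z t - z 0)) {0..t}"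
  shows "sq_int z"
proof -
  have cz: "continuous_on {0..} z"
    using z by (rule continuous_on_half_line_integral)
  have ci: "(\<lambda>t. (norm (z t))\<^sup>2) integrable_on {0..T}" for T
    using continuous_on_subset[OF cz, of "{0..T}"]
    by (intro integrable_continuous_real continuous_intros) auto
  have f2: "(\<lambda>t. (norm (f t))\<^sup>2) integrable_on {0..}"
    using f by (simp add: sq_int_def)
  have f2T: "(\<lambda>t. (norm (f t))\<^sup>2) integrable_on {0..T}" for T
    using f2 by (rule integrable_on_subinterval) auto
  define K where "K = ((norm (z 0))\<^sup>2 + integral {0..} (\<lambda>t. (norm (f t))\<^sup>2) / a) / a"
  have "(\<lambda>t. (norm (z t))\<^sup>2) integrable_on {0..}"
  proof (rule integrable_on_half_line_bounded)
    fix T :: real assume T: "0 \<le> T"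
    define g where "g s = L (z s) + f s" for s
    have "(\<lambda>s. L (z s)) absolutely_integrable_on {0..T}"
      using linear_continuous_on_compose[OF continuous_on_subset[OF cz, of "{0..T}"] L]
      by (intro absolutely_integrable_continuous_real) auto
    then have ga: "g absolutely_integrable_on {0..T}"
      unfolding g_def using sq_int_absolutely_integrable[OF f] by (rule set_integral_add)
    have "((\<lambda>t. z t \<bullet> g t + g t \<bullet> z t) has_integral (z T \<bullet> z T - z 0 \<bullet> z 0)) {0..T}"
      using z by (intro has_integral_inner_by_parts T ga) (auto simp: g_def)
    moreover have "((\<lambda>t. (1/a) * (norm (f t))\<^sup>2 - a * (norm (z t))\<^sup>2) has_integral
        ((1/a) * integral {0..T} (\<lambda>t. (norm (f t))\<^sup>2) - a * integral {0..T} (\<lambda>t. (norm (z t))\<^sup>2))) {0..T}"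
      using ci f2T by (intro has_integral_diff has_integral_mult_right) auto
    ultimately have "z T \<bullet> z T - z 0 \<bullet> z 0 \<le>
       (1/a) * integral {0..T} (\<lambda>t. (norm (f t))\<^sup>2) - a * integral {0..T} (\<lambda>t. (norm (z t))\<^sup>2)"
    proof (rule has_integral_le)
      fix t
      \<comment> \<open>Young's inequality with weight \<open>a\<close>, so that exactly half of the
        damping is used.\<close>
      have "0 \<le> (norm (a *\<^sub>R z t - f t))\<^sup>2 / a" using a by simp
      also have "(norm (a *\<^sub>R z t - f t))\<^sup>2 = a * a * (z t \<bullet> z t) - 2 * a * (z t \<bullet> f t) + f t \<bullet> f t"
        unfolding power2_norm_eq_inner by (simp add: inner_diff inner_commute[of "f t" "z t"] algebra_simps)
      also have "\<dots> / a = a * (norm (z t))\<^sup>2 - 2 * (z t \<bullet> f t) + (1/a) * (norm (f t))\<^sup>2"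
        using a(1) unfolding power2_norm_eq_inner by (simp add: add_divide_distrib diff_divide_distrib)
      finally have "2 * (z t \<bullet> f t) \<le> a * (norm (z t))\<^sup>2 + (1/a) * (norm (f t))\<^sup>2" by simp
      then show "z t \<bullet> g t + g t \<bullet> z t \<le> (1/a) * (norm (f t))\<^sup>2 - a * (norm (z t))\<^sup>2"
        using a(2)[of "z t"] by (simp add: g_def inner_add inner_commute)
    qed
    moreover have "integral {0..T} (\<lambda>t. (norm (f t))\<^sup>2) \<le> integral {0..} (\<lambda>t. (norm (f t))\<^sup>2)"
      using f2 f2T by (intro integral_subset_le) auto
    then have "(1/a) * integral {0..T} (\<lambda>t. (norm (f t))\<^sup>2) \<le> (1/a) * integral {0..} (\<lambda>t. (norm (f t))\<^sup>2)"
      using a by (intro mult_left_mono) auto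
    ultimately have "a * integral {0..T} (\<lambda>t. (norm (z t))\<^sup>2) \<le>
       (norm (z 0))\<^sup>2 + integral {0..} (\<lambda>t. (norm (f t))\<^sup>2) / a"
      by (simp add: power2_norm_eq_inner) (use inner_ge_zero[of "z T"] in linarith)
    then show "integral {0..T} (\<lambda>t. (norm (z t))\<^sup>2) \<le> K"
      using a by (simp add: K_def field_simps)
  qed (use ci in auto)
  then show ?thesis
    using cz by (auto simp: sq_int_def intro!: continuous_imp_measurable_on_sets_lebesgue)
qed

section \<open>Eigenvalue shifts and annihilating polynomials of a complex matrix\<close>

lemma linear_matrix_shift:
  fixes M :: "complex^'m^'m"
  shows "linear (\<lambda>v. M *v v - \<mu> *s v)"
  by (rule linearI)
    (auto simp: vec_eq_iff matrix_vector_mult_def algebra_simps sum.distrib scaleR_sum_right)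

text \<open>The product of the factors \<open>M - \<mu> I\<close> applied to a vector, the head of
  the list acting first. A list, with repetitions allowed, is what the induction that peels off
  factors runs over.\<close>

primrec shift_prod :: "complex^'m^'m \<Rightarrow> complex list \<Rightarrow> complex^'m \<Rightarrow> complex^'m" where
  "shift_prod M [] v = v"
| "shift_prod M (\<mu> # ms) v = shift_prod M ms (M *v v - \<mu> *s v)"

lemma cvec_arith:
  fixes M :: "complex^'m^'m"
  shows "M *v (a - b) = M *v a - M *v b" "M *v (\<mu> *s a) = \<mu> *s (M *v a)"
    "\<mu> *s (a - b) = \<mu> *s a - \<mu> *s b"
    "\<mu> *s (\<nu> *s a) = \<nu> *s (\<mu> *s a)"
  by (auto simp: vec_eq_iff matrix_vector_mult_def algebra_simps sum_subtractf sum_distrib_left)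

text \<open>All factors are polynomials in \<open>M\<close> and commute, so the innermost factor can
  be moved outside. In \<open>annihilating_shifts\<close> this turns a product of shifts into an
  eigenvector.\<close>

lemma shift_prod_shift:
  "shift_prod M ms (M *v v - \<mu> *s v) = M *v shift_prod M ms v - \<mu> *s shift_prod M ms v"
proof (induction ms arbitrary: v)
  case (Cons \<nu> ms)
  have "M *v (M *v v - \<mu> *s v) - \<nu> *s (M *v v - \<mu> *s v)
      = M *v (M *v v - \<nu> *s v) - \<mu> *s (M *v v - \<nu> *s v)"
    by (simp add: cvec_arith algebra_simps)
  then show ?case using Cons.IH[of "M *v v - \<nu> *s v"] by (simp only: shift_prod.simps)
qed simp

text \<open>The signal \<open>w = M z - \<mu> z\<close> solves an equation of the same kind and is annihilated by one factor
  fewer; and \<open>dz/dt = \<mu> z + (w + f)\<close> is a stable scalar equation.\<close>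

lemma sq_int_of_annihilator:
  fixes M :: "complex^'m^'m"
  assumes "\<forall>\<mu>\<in>set ms. Re \<mu> < 0"
  shows "sq_int f \<Longrightarrow> (\<And>t. t \<ge> 0 \<Longrightarrow> ((\<lambda>s. M *v z s + f s) has_integral (z t - z 0)) {0..t})
    \<Longrightarrow> (\<And>t. t \<ge> 0 \<Longrightarrow> shift_prod M ms (z t) = 0) \<Longrightarrow> sq_int z"
  using assms
proof (induction ms arbitrary: z f)
  case Nil
  then show ?case using sq_int_cong[of z "\<lambda>_. 0"] by simp
next
  case (Cons \<mu> ms)
  define h where "h v = M *v v - \<mu> *s v" for v
  have h: "linear h" "bounded_linear h"
    unfolding h_def using linear_matrix_shift[of M \<mu>] by (auto simp: linear_conv_bounded_linear)
  have w: "sq_int (\<lambda>t. h (z t))"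
  proof (rule Cons.IH)
    show "sq_int (\<lambda>t. h (f t))" using h(2) Cons.prems(1) by (rule sq_int_linear)
    show "((\<lambda>s. M *v h (z s) + h (f s)) has_integral (h (z t) - h (z 0))) {0..t}" if "t \<ge> 0" for t
    proof -
      have "((h \<circ> (\<lambda>s. M *v z s + f s)) has_integral h (z t - z 0)) {0..t}"
        using Cons.prems(2)[OF that] h(2) by (rule has_integral_linear)
      moreover have "h (M *v v + w) = M *v h v + h w" for v w
        by (simp add: linear_add[OF h(1)]) (simp add: h_def cvec_arith)
      ultimately show ?thesis by (simp add: o_def linear_diff[OF h(1)])
    qed
    show "shift_prod M ms (h (z t)) = 0" if "t \<ge> 0" for t
      using Cons.prems(3)[OF that] by (simp add: h_def)
    show "\<forall>\<mu>\<in>set ms. Re \<mu> < 0" using Cons.prems(4) by simp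
  qed
  show ?case
  proof (rule sq_int_decay[of "\<lambda>v. \<mu> *s v" "- Re \<mu>"])
    show "linear (\<lambda>v::complex^'m. \<mu> *s v)"
      by (rule linearI) (auto simp: vec_eq_iff algebra_simps)
    show "- Re \<mu> > 0" using Cons.prems(4) by simp
    \<comment> \<open>The inner product on complex vectors is the real one, for which multiplication
      by the imaginary part of \<open>\<mu>\<close> is skew; only \<open>Re \<mu>\<close>
      contributes.\<close>
    show "v \<bullet> (\<mu> *s v) \<le> - (- Re \<mu>) * (norm v)\<^sup>2" for v :: "complex^'m"
    proof -
      have "v \<bullet> (\<mu> *s v) = (\<Sum>i\<in>UNIV. Re \<mu> * (v $ i \<bullet> v $ i))"
        unfolding inner_vec_def by (rule sum.cong) (auto simp: inner_complex_def algebra_simps)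
      also have "\<dots> = Re \<mu> * (v \<bullet> v)"
        unfolding inner_vec_def by (simp add: sum_distrib_left)
      finally show ?thesis by (simp add: power2_norm_eq_inner)
    qed
    show "sq_int (\<lambda>t. h (z t) + f t)" using w Cons.prems(1) by (rule sq_int_add)
    show "((\<lambda>s. \<mu> *s z s + (h (z s) + f s)) has_integral (z t - z 0)) {0..t}" if "t \<ge> 0" for t
      using Cons.prems(2)[OF that] by (simp add: h_def algebra_simps)
  qed
qed

text \<open>The vector \<open>p(M) v\<close>, by Horner's scheme acting on vectors, so that
  splitting off a root of \<open>p\<close> becomes a shift of the argument.\<close>

definition poly_mat :: "complex^'m^'m \<Rightarrow> complex poly \<Rightarrow> complex^'m \<Rightarrow> complex^'m" where
  "poly_mat M p = fold_coeffs (\<lambda>a f v. a *s v + f (M *v v)) p (\<lambda>v. 0)"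

lemma poly_mat_0 [simp]: "poly_mat M 0 v = 0"
  by (simp add: poly_mat_def)

lemma poly_mat_pCons [simp]: "poly_mat M (pCons a p) v = a *s v + poly_mat M p (M *v v)"
  by (cases "p = 0 \<and> a = 0") (auto simp: poly_mat_def)

lemma poly_mat_diff: "poly_mat M p (v - w) = poly_mat M p v - poly_mat M p w"
proof (induction p arbitrary: v w)
  case (pCons a p)
  then show ?case by (simp add: cvec_arith algebra_simps)
qed simp

lemma poly_mat_scale: "poly_mat M p (c *s v) = c *s poly_mat M p v"
proof (induction p arbitrary: v)
  case (pCons a p)
  then show ?case by (simp add: cvec_arith(2,4) vector_add_ldistrib)
qed simp

lemma poly_mat_add: "poly_mat M (p + q) v = poly_mat M p v + poly_mat M q v"
proof (induction p q arbitrary: v rule: poly_induct2)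
  case (pCons a p b q)
  then show ?case by (simp add: vector_sadd_rdistrib algebra_simps)
qed simp

lemma poly_mat_smult: "poly_mat M (smult c p) v = c *s poly_mat M p v"
proof (induction p arbitrary: v)
  case (pCons a p)
  then show ?case by (simp add: vector_add_ldistrib vector_smult_assoc)
qed simp

lemma poly_mat_sum: "poly_mat M (\<Sum>i\<in>I. p i) v = (\<Sum>i\<in>I. poly_mat M (p i) v)"
  by (induction I rule: infinite_finite_induct) (auto simp: poly_mat_add)

lemma poly_mat_root: "poly_mat M ([:- \<mu>, 1:] * q) v = poly_mat M q (M *v v - \<mu> *s v)"
proof -
  have "[:- \<mu>, 1:] * q = smult (- \<mu>) q + pCons 0 q" by simp
  then show ?thesis
    by (simp only: poly_mat_add poly_mat_smult poly_mat_diff poly_mat_scale poly_mat_pCons)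
      (simp add: vec_eq_iff)
qed

text \<open>Linear factors of \<open>p\<close> are split off by induction on the degree. A root with
  nonnegative real part can be discarded: the product of the remaining shifts would otherwise yield
  an eigenvector for it. The set \<open>X\<close> is general because after splitting off a root only
  the image of \<open>X\<close> under \<open>M - \<mu> I\<close> is known to be annihilated.\<close>

lemma annihilating_shifts:
  fixes M :: "complex^'m^'m"
  assumes hw: "\<And>\<mu> v. v \<noteq> 0 \<Longrightarrow> M *v v = \<mu> *s v \<Longrightarrow> Re \<mu> < 0"
  shows "p \<noteq> 0 \<Longrightarrow> (\<And>v. v \<in> X \<Longrightarrow> poly_mat M p v = 0) \<Longrightarrow>
    \<exists>ms. (\<forall>\<mu>\<in>set ms. Re \<mu> < 0) \<and> (\<forall>v\<in>X. shift_prod M ms v = 0)"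
proof (induction "degree p" arbitrary: p X)
  case 0
  then obtain c where "p = [:c:]" "c \<noteq> 0"
    by (metis degree_eq_zeroE pCons_0_0)
  then have "v = 0" if "v \<in> X" for v
    using 0(3)[OF that] by (simp add: vector_mul_eq_0)
  then show ?case by (intro exI[of _ "[]"]) simp
next
  case (Suc n)
  obtain \<mu> where "poly p \<mu> = 0"
    using alg_closed_imp_poly_has_root[of p] Suc.hyps(2) by auto
  then obtain q where q: "p = [:- \<mu>, 1:] * q"
    unfolding poly_eq_0_iff_dvd by (rule dvdE)
  have q0: "q \<noteq> 0" using q Suc.prems by auto
  then have "degree p = Suc (degree q)"
    unfolding q by (subst degree_mult_eq) auto
  then have "n = degree q" using Suc.hyps(2) by simp
  moreover have "poly_mat M q v = 0" if "v \<in> (\<lambda>v. M *v v - \<mu> *s v) ` X" for v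
    using that Suc.prems(2) unfolding q poly_mat_root by auto
  ultimately have "\<exists>ms. (\<forall>\<mu>\<in>set ms. Re \<mu> < 0) \<and>
      (\<forall>v\<in>(\<lambda>v. M *v v - \<mu> *s v) ` X. shift_prod M ms v = 0)"
    using q0 by (intro Suc.hyps(1))
  then obtain ms where ms: "\<forall>\<mu>\<in>set ms. Re \<mu> < 0"
    "\<forall>v\<in>(\<lambda>v. M *v v - \<mu> *s v) ` X. shift_prod M ms v = 0"
    by blast
  show ?case
  proof (cases "Re \<mu> < 0")
    case True
    then show ?thesis using ms by (intro exI[of _ "\<mu> # ms"]) auto
  next
    case False
    have "shift_prod M ms v = 0" if "v \<in> X" for v
    proof -
      have "M *v shift_prod M ms v = \<mu> *s shift_prod M ms v"
        using ms(2) that shift_prod_shift[of M ms v \<mu>] by simp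
      then show ?thesis using hw False by blast
    qed
    then show ?thesis using ms(1) by blast
  qed
qed

text \<open>A weak form of Cayley-Hamilton: the powers of \<open>M\<close> live in a
  finite-dimensional space, so a finite number of them satisfy a linear relation. Which polynomial
  arises does not matter, as roots that are not stable eigenvalues are handled afterwards.\<close>

lemma ex_annihilating_poly:
  fixes M :: "complex^'m^'m"
  shows "\<exists>p. p \<noteq> 0 \<and> (\<forall>v. poly_mat M p v = 0)"
proof -
  define P where "P k = (((**) M) ^^ k) (mat 1)" for k
  have monom: "poly_mat M (monom c k) v = c *s (P k *v v)" for c k v
  proof (induction k arbitrary: v)
    case 0
    then show ?case by (simp add: P_def monom_0)
  next
    case (Suc k)
    have "P k ** M = M ** P k" for k
    proof (induction k)
      case (Suc k)
      have "P (Suc k) ** M = M ** (P k ** M)" by (simp add: P_def matrix_mul_assoc)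
      then show ?case unfolding Suc by (simp add: P_def)
    qed (simp add: P_def)
    then have "P k *v (M *v v) = P (Suc k) *v v"
      by (simp add: P_def matrix_vector_mul_assoc)
    then show ?case using Suc by (simp add: monom_Suc)
  qed
  \<comment> \<open>The real dimension of the matrix space. Coinciding powers form a separate case
    because linear dependence concerns the set of powers, from which repetitions disappear.\<close>
  define N where "N = DIM(complex^'m^'m)"
  show ?thesis
  proof (cases "inj_on P {..N}")
    case False
    then obtain i j where ij: "P i = P j" "i \<noteq> j" by (auto simp: inj_on_def)
    have "coeff (monom 1 i + monom (-1) j) i = (1::complex)" using ij by simp
    then have "monom 1 i + monom (-1) j \<noteq> (0::complex poly)" by (metis coeff_0 zero_neq_one)
    moreover have "poly_mat M (monom 1 i + monom (-1) j) v = 0" for v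
      by (simp only: poly_mat_add monom ij(1)) (simp add: vec_eq_iff)
    ultimately show ?thesis by blast
  next
    case True
    then have "card (P ` {..N}) > N" by (simp add: card_image)
    then have "dependent (P ` {..N})"
      unfolding N_def by (intro dependent_biggerset) auto
    then obtain u where u: "\<exists>A\<in>P ` {..N}. u A \<noteq> 0" "(\<Sum>A\<in>P ` {..N}. u A *\<^sub>R A) = 0"
      by (auto simp: dependent_finite)
    define p where "p = (\<Sum>k\<le>N. monom (complex_of_real (u (P k))) k)"
    obtain k where k: "k \<le> N" "u (P k) \<noteq> 0" using u(1) by auto
    have "coeff p k = of_real (u (P k))"
      using k by (simp add: p_def coeff_sum)
    then have "p \<noteq> 0" using k by auto
    moreover have "poly_mat M p v = 0" for v
    proof -
      have s: "(\<Sum>k\<le>N. u (P k) *\<^sub>R P k) = 0"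
        using u(2) True by (simp add: sum.reindex)
      have "of_real r *s (A *v v) = (r *\<^sub>R A) *v v" for r and A :: "complex^'m^'m"
        by (simp add: vec_eq_iff matrix_vector_mult_def scaleR_conv_of_real[where 'a=complex] sum_distrib_left algebra_simps)
      then have "poly_mat M p v = (\<Sum>k\<le>N. (u (P k) *\<^sub>R P k) *v v)"
        by (simp add: p_def poly_mat_sum monom)
      also have "\<dots> = (\<Sum>k\<le>N. u (P k) *\<^sub>R P k) *v v"
        by (induction N) (auto simp: matrix_vector_mult_add_rdistrib)
      finally show ?thesis using s by simp
    qed
    ultimately show ?thesis by blast
  qed
qed

section \<open>Systems, supply rates and the linear matrix inequality\<close>

text \<open>Gauge-integral form of \<open>L2_inner\<close>. The default value 0 for a non-integrable
  product makes \<open>ip f f\<close> nonnegative without any hypothesis.\<close>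

definition ip :: "(real \<Rightarrow> 'a::euclidean_space) \<Rightarrow> (real \<Rightarrow> 'a) \<Rightarrow> real" where
  "ip f g = integral {0..} (\<lambda>t. f t \<bullet> g t)"

lemma integrable_inner: "sq_int f \<Longrightarrow> sq_int g \<Longrightarrow> (\<lambda>t. f t \<bullet> g t) integrable_on {0..}"
  using sq_int_inner by (auto simp: absolutely_integrable_on_def)

lemma ip_add_left: "sq_int f \<Longrightarrow> sq_int g \<Longrightarrow> sq_int h \<Longrightarrow> ip (\<lambda>t. f t + g t) h = ip f h + ip g h"
  unfolding ip_def inner_add_left by (intro Henstock_Kurzweil_Integration.integral_add integrable_inner)

lemma ip_commute: "ip f g = ip g f"
  by (simp add: ip_def inner_commute)

lemma ip_add_right: "sq_int f \<Longrightarrow> sq_int g \<Longrightarrow> sq_int h \<Longrightarrow> ip h (\<lambda>t. f t + g t) = ip h f + ip h g"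
  using ip_add_left by (metis ip_commute)

lemma ip_scaleR_left: "ip (\<lambda>t. c *\<^sub>R f t) h = c * ip f h"
  by (simp add: ip_def)

lemma ip_scaleR_right: "ip h (\<lambda>t. c *\<^sub>R f t) = c * ip h f"
  by (simp add: ip_def)

lemma ip_self_nonneg: "0 \<le> ip f f"
proof (cases "(\<lambda>t. f t \<bullet> f t) integrable_on {0..}")
  case True
  then show ?thesis unfolding ip_def by (rule integral_nonneg) simp
next
  case False
  then show ?thesis by (simp add: ip_def not_integrable_integral)
qed

lemma ip_Cauchy_Schwarz:
  assumes "sq_int u" "sq_int y" "ip u u > 0"
  shows "(ip u y)\<^sup>2 \<le> ip u u * ip y y"
proof -
  \<comment> \<open>The minimiser of the squared norm of \<open>y + c u\<close>.\<close>
  define c where "c = - ip u y / ip u u"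
  have "0 \<le> ip (\<lambda>t. y t + c *\<^sub>R u t) (\<lambda>t. y t + c *\<^sub>R u t)" by (rule ip_self_nonneg)
  also have "\<dots> = ip y y + 2 * c * ip u y + c * c * ip u u"
    using assms by (simp add: ip_add_left ip_add_right sq_int_add sq_int_scaleR ip_scaleR_left
        ip_scaleR_right ip_commute[of y u] algebra_simps)
  also have "\<dots> = ip y y - (ip u y)\<^sup>2 / ip u u"
    using assms(3) by (simp add: c_def field_simps power2_eq_square)
  finally show ?thesis using assms(3) by (simp add: field_simps)
qed

lemma in_L2_iff_sq_int: "in_L2 u \<longleftrightarrow> sq_int u"
proof -
  have "integrable (lebesgue_on {0..}) (\<lambda>t. (norm (u t))\<^sup>2) \<longleftrightarrow> (\<lambda>t. (norm (u t))\<^sup>2) integrable_on {0..}"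
    using integrable_on_lebesgue_on[of "{0..}" "\<lambda>t. (norm (u t))\<^sup>2"]
      absolutely_integrable_imp_integrable[where f="\<lambda>t. (norm (u t))\<^sup>2" and S="{0..}"]
      nonnegative_absolutely_integrable_1[where f="\<lambda>t. (norm (u t))\<^sup>2" and A="{0..}"] by auto
  then show ?thesis by (simp add: in_L2_def sq_int_def)
qed

lemma L2_inner_eq_ip: "sq_int u \<Longrightarrow> sq_int y \<Longrightarrow> L2_inner u y = ip u y"
  unfolding L2_inner_def ip_def
  by (intro lebesgue_integral_eq_integral absolutely_integrable_imp_integrable sq_int_inner) auto

lemma L2_null_iff:
  assumes "sq_int u" shows "L2_null u \<longleftrightarrow> ip u u = 0"
proof -
  have i: "integrable (lebesgue_on {0..}) (\<lambda>t. u t \<bullet> u t)"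
    using assms by (intro absolutely_integrable_imp_integrable sq_int_inner) auto
  have "ip u u = 0 \<longleftrightarrow> (LINT t|lebesgue_on {0..}. u t \<bullet> u t) = 0"
    using L2_inner_eq_ip[OF assms assms] by (simp add: L2_inner_def)
  also have "\<dots> \<longleftrightarrow> (AE t in lebesgue_on {0..}. u t \<bullet> u t = 0)"
    using i by (rule integral_nonneg_eq_0_iff_AE) auto
  finally show ?thesis by (simp add: L2_null_def)
qed

lemma bounded_linear_matrix: "bounded_linear (\<lambda>v. (M::real^'a^'b) *v v)"
  by (rule matrix_vector_mul_bounded_linear)

lemma lti_state_at_0:
  assumes "lti_state A B x0 u x" shows "x 0 = x0"
proof -
  have "((\<lambda>s. A *v x s + B *v u s) has_integral (x 0 - x0)) {0..0}"
    using assms unfolding lti_state_def by blast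
  moreover have "((\<lambda>s. A *v x s + B *v u s) has_integral 0) {0..0}"
    by (simp add: has_integral_refl)
  ultimately have "x 0 - x0 = 0" by (rule has_integral_unique)
  then show ?thesis by simp
qed

text \<open>The state is complexified, so that the eigenvalue shifts can act on it, and recovered by
  taking real parts. All shifts have \<open>Re \<mu> < 0\<close> because the matrix is
  Hurwitz.\<close>

lemma lti_state_sq_int:
  fixes A :: "real^'m^'m" and B :: "real^'n^'m"
  assumes hw: "hurwitz A" and u: "sq_int u" and x: "lti_state A B x0 u x"
  shows "sq_int x"
proof -
  define c where "c v = (\<chi> i. complex_of_real (v $ i))" for v :: "real^'m"
  have c: "bounded_linear c"
    unfolding linear_conv_bounded_linear[symmetric]
    by (rule linearI) (auto simp: c_def vec_eq_iff scaleR_conv_of_real[where 'a=complex])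
  define r where "r v = (\<chi> i. Re (v $ i))" for v :: "complex^'m"
  have r: "bounded_linear r"
    unfolding linear_conv_bounded_linear[symmetric]
    by (rule linearI) (auto simp: r_def vec_eq_iff)
  have cA: "c (A *v v + w) = cmat A *v c v + c w" for v w
    by (simp add: c_def vec_eq_iff matrix_vector_mult_def map_matrix_def)
  obtain p where p: "p \<noteq> 0" "\<And>v. poly_mat (cmat A) p v = 0"
    using ex_annihilating_poly by blast
  obtain ms where ms: "\<forall>\<mu>\<in>set ms. Re \<mu> < 0" "\<forall>v\<in>UNIV. shift_prod (cmat A) ms v = 0"
    using annihilating_shifts[of "cmat A" p UNIV] hw p unfolding hurwitz_def by blast
  have "sq_int (\<lambda>t. c (x t))"
  proof (rule sq_int_of_annihilator[OF ms(1)])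
    show "sq_int (\<lambda>t. c (B *v u t))"
      using sq_int_linear[OF c sq_int_linear[OF bounded_linear_matrix u]] .
    show "((\<lambda>s. cmat A *v c (x s) + c (B *v u s)) has_integral (c (x t) - c (x 0))) {0..t}"
      if "t \<ge> 0" for t
    proof -
      have "((\<lambda>s. A *v x s + B *v u s) has_integral (x t - x 0)) {0..t}"
        using x that lti_state_at_0[OF x] unfolding lti_state_def by auto
      then have "((c \<circ> (\<lambda>s. A *v x s + B *v u s)) has_integral c (x t - x 0)) {0..t}"
        using c by (rule has_integral_linear)
      then show ?thesis
        by (simp add: o_def cA linear_diff[OF bounded_linear.linear[OF c]])
    qed
    show "shift_prod (cmat A) ms (c (x t)) = 0" for t using ms(2) by blast
  qed
  from sq_int_linear[OF r this] show ?thesis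
    by (simp add: r_def c_def)
qed

section \<open>Stacked vectors, block matrices and the quadratic form of the inequality\<close>

definition join_vec :: "real^'a \<Rightarrow> real^'b \<Rightarrow> real^('a+'b)" where
  "join_vec x u = (\<chi> i. case i of Inl a \<Rightarrow> x $ a | Inr b \<Rightarrow> u $ b)"

lemma sum_UNIV_sum: "(\<Sum>i\<in>(UNIV::('a::finite+'b::finite) set). f i) = (\<Sum>a\<in>UNIV. f (Inl a)) + (\<Sum>b\<in>UNIV. f (Inr b))"
  by (simp add: UNIV_Plus_UNIV[symmetric] sum.Plus del: UNIV_Plus_UNIV)

lemma inner_join_vec: "join_vec a b \<bullet> join_vec c d = a \<bullet> c + b \<bullet> d"
  by (simp add: join_vec_def inner_vec_def sum_UNIV_sum)

lemma ex_join_vec: "\<exists>x u. v = join_vec x u"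
  by (rule exI[of _ "\<chi> a. v $ Inl a"], rule exI[of _ "\<chi> b. v $ Inr b"])
    (auto simp: join_vec_def vec_eq_iff split: sum.split)

lemma block_mat_join_vec: "block_mat M11 M12 M21 M22 *v join_vec x u = join_vec (M11 *v x + M12 *v u) (M21 *v x + M22 *v u)"
  by (auto simp: join_vec_def block_mat_def vec_eq_iff matrix_vector_mult_def sum_UNIV_sum split: sum.split)

lemma transpose_block_mat: "transpose (block_mat M11 M12 M21 M22) =
    block_mat (transpose M11) (transpose M21) (transpose M12) (transpose M22)"
  by (auto simp: block_mat_def vec_eq_iff transpose_def split: sum.split)

lemma inner_transpose_mult: "v \<bullet> (transpose M *v w) = (M *v v) \<bullet> (w::real^'a)"
  by (metis dot_lmul_matrix inner_commute transpose_matrix_vector)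

lemma symmetric_mat_congruence: "symmetric_mat N \<Longrightarrow> symmetric_mat (transpose M ** N ** M)"
  by (simp add: symmetric_mat_def matrix_transpose_mul matrix_mul_assoc)

lemma symmetric_mat_diff: "symmetric_mat M \<Longrightarrow> symmetric_mat N \<Longrightarrow> symmetric_mat (M - N)"
  by (simp add: symmetric_mat_def transpose_def vec_eq_iff)

lemma quadratic_form_congruence:
  "v \<bullet> ((transpose M ** N ** M) *v v) = (M *v v) \<bullet> (N *v (M *v (v::real^'a)))"
  by (simp add: inner_transpose_mult[symmetric] matrix_vector_mul_assoc[symmetric])

text \<open>Equals \<open>\<sigma> (|y - lc u|^2 - r^2 |u|^2)\<close>, the quadratic form of
  \<open>Pi_mat \<sigma> lc r\<close> tensored with the identity at the stacked vector of
  \<open>y\<close> and \<open>u\<close>.\<close>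

definition supply_rate :: "real \<Rightarrow> real \<Rightarrow> real \<Rightarrow> 'a::real_inner \<Rightarrow> 'a \<Rightarrow> real" where
  "supply_rate \<sigma> lc r y u = \<sigma> * (y \<bullet> y - 2 * lc * (u \<bullet> y) + (lc\<^sup>2 - r\<^sup>2) * (u \<bullet> u))"

text \<open>The first term is the derivative of the storage function
  \<open>x \<bullet> (P *v x)\<close> along the dynamics, the second is the supply rate at the
  output.\<close>

lemma F_mat_quadratic_form:
  fixes A :: "real^'m^'m" and B :: "real^'n^'m" and C :: "real^'m^'n" and D :: "real^'n^'n"
  assumes "symmetric_mat P"
  shows "join_vec x u \<bullet> (F_mat A B C D \<sigma> lc r P *v join_vec x u) =
    2 * (x \<bullet> (P *v (A *v x + B *v u))) - supply_rate \<sigma> lc r (C *v x + D *v u) u"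
proof -
  define d where "d = A *v x + B *v u"
  define y where "y = C *v x + D *v u"
  have P: "d \<bullet> (P *v x) = x \<bullet> (P *v d)"
    using assms inner_transpose_mult[of d P x] by (simp add: symmetric_mat_def inner_commute)
  have dyn: "block_mat A B (mat 1) 0 *v join_vec x u = join_vec d x"
    and out: "block_mat C D 0 (mat 1) *v join_vec x u = join_vec y u"
    by (simp_all add: block_mat_join_vec d_def y_def)
  have "join_vec d x \<bullet> (block_mat 0 P P 0 *v join_vec d x) = 2 * (x \<bullet> (P *v d))"
    by (simp add: block_mat_join_vec inner_join_vec P)
  moreover have neg: "- (c *\<^sub>R mat 1) *v v = - (c *\<^sub>R v)" for c and v :: "real^'n"
    using scaleR_matrix_vector_assoc[of "- c" "mat 1" v] by simp
  have "join_vec y u \<bullet> (kron2 (Pi_mat \<sigma> lc r) (mat 1) *v join_vec y u) = supply_rate \<sigma> lc r y u"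
    by (simp add: kron2_def block_mat_join_vec inner_join_vec Pi_mat_def scaleR_matrix_vector_assoc[symmetric]
        supply_rate_def neg inner_add inner_commute[of y u])
      (simp add: algebra_simps inner_commute)
  ultimately show ?thesis
    unfolding F_mat_def matrix_vector_mult_diff_rdistrib inner_diff_right quadratic_form_congruence
      dyn out by (simp add: d_def y_def)
qed

lemma symmetric_F_mat:
  fixes A :: "real^'m^'m" and B :: "real^'n^'m" and C :: "real^'m^'n" and D :: "real^'n^'n"
  assumes "symmetric_mat P" shows "symmetric_mat (F_mat A B C D \<sigma> lc r P)"
  unfolding F_mat_def
proof (intro symmetric_mat_diff symmetric_mat_congruence)
  show "symmetric_mat (block_mat 0 P P 0)"
    using assms by (simp add: symmetric_mat_def transpose_block_mat) (simp add: transpose_def zero_vec_def)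
  have "transpose (c *\<^sub>R mat 1 :: real^'n^'n) = c *\<^sub>R mat 1"
    "transpose (- (c *\<^sub>R mat 1) :: real^'n^'n) = - (c *\<^sub>R mat 1)" for c
    by (auto simp: transpose_def mat_def vec_eq_iff)
  then show "symmetric_mat (kron2 (Pi_mat \<sigma> lc r) (mat 1 :: real^'n^'n))"
    by (simp add: symmetric_mat_def kron2_def transpose_block_mat Pi_mat_def)
qed

lemma neg_semidef_F_mat_iff:
  assumes "symmetric_mat P"
  shows "neg_semidef (F_mat A B C D \<sigma> lc r P) \<longleftrightarrow>
    (\<forall>x u. 2 * (x \<bullet> (P *v (A *v x + B *v u))) \<le> supply_rate \<sigma> lc r (C *v x + D *v u) u)"
  unfolding neg_semidef_def
  using symmetric_F_mat[OF assms] F_mat_quadratic_form[OF assms] ex_join_vec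
  by (metis diff_le_0_iff_le)

text \<open>The bracket is \<open>|z - lc|^2 - r^2\<close>: for \<open>\<sigma> = 1\<close> the
  region is the outside of an open disk, for \<open>\<sigma> = -1\<close> a closed disk.\<close>

lemma S_region_Pi_mat:
  "z \<in> S_region (Pi_mat \<sigma> lc r) \<longleftrightarrow> 0 \<le> \<sigma> * ((cmod z)\<^sup>2 - 2 * lc * Re z + (lc\<^sup>2 - r\<^sup>2))"
  by (simp add: S_region_def Let_def UNIV_2 Pi_mat_def cmod_power2) (simp add: power2_eq_square algebra_simps)

lemma closed_S_region: "closed (S_region Q)"
  unfolding S_region_def Let_def UNIV_2
  by (simp, intro closed_Collect_le continuous_intros)

lemma supply_integral:
  assumes "sq_int y" "sq_int u"
  shows "(\<lambda>t. supply_rate \<sigma> lc r (y t) (u t)) absolutely_integrable_on {0..}"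
    and "integral {0..} (\<lambda>t. supply_rate \<sigma> lc r (y t) (u t))
      = \<sigma> * (ip y y - 2 * lc * ip u y + (lc\<^sup>2 - r\<^sup>2) * ip u u)"
proof -
  note i = sq_int_inner[OF assms(1,1)] sq_int_inner[OF assms(2,1)] sq_int_inner[OF assms(2,2)]
  show "(\<lambda>t. supply_rate \<sigma> lc r (y t) (u t)) absolutely_integrable_on {0..}"
    unfolding supply_rate_def using i by (intro set_integrable_mult_right set_integral_add set_integral_diff) auto
  have "((\<lambda>t. supply_rate \<sigma> lc r (y t) (u t)) has_integral
      \<sigma> * (ip y y - 2 * lc * ip u y + (lc\<^sup>2 - r\<^sup>2) * ip u u)) {0..}"
    unfolding supply_rate_def ip_def
    using i by (intro has_integral_mult_right has_integral_add has_integral_diff integrable_integral)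
      (auto simp: absolutely_integrable_on_def)
  then show "integral {0..} (\<lambda>t. supply_rate \<sigma> lc r (y t) (u t))
      = \<sigma> * (ip y y - 2 * lc * ip u y + (lc\<^sup>2 - r\<^sup>2) * ip u u)"
    by (rule integral_unique)
qed

lemma sq_int_output:
  "sq_int x \<Longrightarrow> sq_int u \<Longrightarrow> sq_int (\<lambda>t. (C::real^'m^'k) *v x t + (D::real^'n^'k) *v u t)"
  by (intro sq_int_add sq_int_linear[OF bounded_linear_matrix])

text \<open>Integrating the hypothesis from rest bounds the storage at time \<open>T\<close> by the
  supply up to \<open>T\<close>. \<open>P\<close> need not be semidefinite, so a negative total
  supply is refuted only at a late \<open>T\<close> with \<open>x T\<close> close to zero.\<close>

lemma dissipation:
  fixes A :: "real^'m^'m" and B :: "real^'n^'m"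
  assumes x: "lti_state A B 0 u x" "sq_int x" and u: "sq_int u"
    and P: "symmetric_mat P"
    and w: "w absolutely_integrable_on {0..}"
    and diss: "\<And>t. t \<ge> 0 \<Longrightarrow> 2 * (x t \<bullet> (P *v (A *v x t + B *v u t))) \<le> w t"
  shows "0 \<le> integral {0..} w"
proof (rule ccontr)
  define J where "J = integral {0..} w"
  assume "\<not> 0 \<le> integral {0..} w"
  then have J: "J < 0" by (simp add: J_def)
  have wi: "w integrable_on {0..}" using w by (simp add: absolutely_integrable_on_def)
  have Psym: "a \<bullet> (P *v b) = (P *v a) \<bullet> b" for a b
    using P inner_transpose_mult[of a P b] by (simp add: symmetric_mat_def)
  have le: "x T \<bullet> (P *v x T) \<le> integral {0..T} w" if T: "T \<ge> 0" for T
  proof -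
    define d where "d s = A *v x s + B *v u s" for s
    have d: "(d has_integral (x t - x 0)) {0..t}" if "t \<ge> 0" for t
      using x(1) that lti_state_at_0[OF x(1)] unfolding lti_state_def d_def by auto
    have dabs: "d absolutely_integrable_on {0..T}"
      unfolding d_def by (intro sq_int_absolutely_integrable sq_int_output x u)
    have "((\<lambda>t. x t \<bullet> (P *v d t) + d t \<bullet> (P *v x t)) has_integral
        (x T \<bullet> (P *v x T) - x 0 \<bullet> (P *v x 0))) {0..T}"
    proof (rule has_integral_inner_by_parts[OF T])
      show "(\<lambda>t. P *v d t) absolutely_integrable_on {0..T}"
        using absolutely_integrable_linear[OF dabs bounded_linear_matrix] by (simp add: o_def)
      show "((\<lambda>t. P *v d t) has_integral (P *v x t - P *v x 0)) {0..t}" if "t \<ge> 0" for t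
        using has_integral_linear[OF d[OF that] bounded_linear_matrix[of P]]
        by (simp add: o_def matrix_vector_mult_diff_distrib)
    qed (use d dabs in auto)
    moreover have "x 0 = 0" by (rule lti_state_at_0[OF x(1)])
    ultimately have *: "((\<lambda>t. x t \<bullet> (P *v d t) + d t \<bullet> (P *v x t)) has_integral (x T \<bullet> (P *v x T))) {0..T}"
      by simp
    show ?thesis
    proof (rule has_integral_le[OF *])
      show "(w has_integral integral {0..T} w) {0..T}"
        using integrable_on_subinterval[OF wi, of 0 T] by (simp add: integrable_integral)
      fix t assume "t \<in> {0..T}"
      then show "x t \<bullet> (P *v d t) + d t \<bullet> (P *v x t) \<le> w t"
        using diss[of t] Psym[of "x t" "d t"] by (simp add: inner_commute[of "d t"]) (simp add: d_def)
    qed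
  qed
  have "\<forall>\<^sub>F T in at_top. integral {0..T} w < J / 2"
    using order_tendstoD(2)[OF integral_tendsto_at_top[OF w], of "J/2"] J by (simp add: J_def)
  then obtain N where N: "\<And>T. T \<ge> N \<Longrightarrow> integral {0..T} w < J / 2"
    by (auto simp: eventually_at_top_linorder)
  obtain K where K: "K > 0" "\<And>v. norm (P *v v) \<le> norm v * K"
    using bounded_linear.pos_bounded[OF bounded_linear_matrix[of P]] by blast
  \<comment> \<open>A state below this size has storage of absolute value at most
    \<open>- J / 2\<close>, while the supply up to a late time is already less than
    \<open>J / 2\<close>.\<close>
  have "0 < - J / 2 / K" using J K by (intro divide_pos_pos) auto
  then obtain T where T: "T \<ge> max 0 N" "norm (x T) < sqrt (- J / 2 / K)"
    using sq_int_small[OF x(2), of "sqrt (- J / 2 / K)" "max 0 N"] real_sqrt_gt_zero by blast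
  have "\<bar>x T \<bullet> (P *v x T)\<bar> \<le> norm (x T) * norm (P *v x T)"
    by (rule Cauchy_Schwarz_ineq2)
  also have "\<dots> \<le> norm (x T) * (norm (x T) * K)"
    by (intro mult_left_mono K) auto
  also have "\<dots> = (norm (x T))\<^sup>2 * K" by (simp add: power2_eq_square)
  also have "\<dots> \<le> (sqrt (- J / 2 / K))\<^sup>2 * K"
    using T K by (intro mult_right_mono power_mono) auto
  also have "\<dots> = - J / 2" using J K by (simp add: field_simps)
  finally have "x T \<bullet> (P *v x T) \<ge> J / 2" by linarith
  then show False using le[of T] N[of T] T by auto
qed

section \<open>The scaled graph in terms of inner products\<close>

definition response_pair ::
  "real^'m^'m \<Rightarrow> real^'n^'m \<Rightarrow> real^'m^'n \<Rightarrow> real^'n^'n \<Rightarrow> (real \<Rightarrow> real^'n) \<Rightarrow> (real \<Rightarrow> real^'n) \<Rightarrow> bool" where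
  "response_pair A B C D u y \<longleftrightarrow> sq_int u \<and> sq_int y \<and> lti_response A B C D u y"

text \<open>A complex number is determined up to conjugation by its modulus and real part, and both
  signs of the phase belong to the graph. This removes \<open>arccos\<close> and the convention for
  vanishing outputs.\<close>

lemma scaled_graph_iff:
  fixes A :: "real^'m^'m" and B :: "real^'n^'m" and C :: "real^'m^'n" and D :: "real^'n^'n"
  shows
  "z \<in> scaled_graph (lti_response A B C D) \<longleftrightarrow>
    (\<exists>u y. response_pair A B C D u y \<and> ip u u > 0 \<and>
       (cmod z)\<^sup>2 = ip y y / ip u u \<and> Re z = ip u y / ip u u)" (is "_ \<longleftrightarrow> ?R")
proof -
  have key: "sg_gain u y * cos (sg_phase u y) = ip u y / ip u u \<and> (sg_gain u y)\<^sup>2 = ip y y / ip u u \<and>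
       0 \<le> sg_gain u y \<and> 0 \<le> sg_phase u y \<and> sg_phase u y \<le> pi"
    if u: "sq_int u" and y: "sq_int y" and pos: "ip u u > 0" for u y :: "real \<Rightarrow> real^'n"
  proof -
    have g: "sg_gain u y = sqrt (ip y y) / sqrt (ip u u)"
      using u y by (simp add: sg_gain_def L2_norm_def L2_inner_eq_ip)
    have cs: "(ip u y)\<^sup>2 \<le> ip u u * ip y y" using u y pos by (rule ip_Cauchy_Schwarz)
    show ?thesis
    proof (cases "ip y y = 0")
      case True
      \<comment> \<open>For a null output the gain is zero, so the default phase has no effect, and
        Cauchy-Schwarz makes the other side vanish too.\<close>
      then have "ip u y = 0" using cs by simp
      then show ?thesis using True g L2_null_iff[OF y] by (simp add: sg_phase_def)
    next
      case False
      then have ypos: "ip y y > 0" using ip_self_nonneg[of y] by simp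
      define q where "q = ip u y / (sqrt (ip u u) * sqrt (ip y y))"
      have "\<bar>ip u y\<bar> \<le> sqrt (ip u u * ip y y)"
        using cs by (simp add: real_le_rsqrt)
      then have q: "\<bar>q\<bar> \<le> 1"
        using pos ypos by (simp add: q_def real_sqrt_mult field_simps)
      have ph: "sg_phase u y = arccos q"
        using False L2_null_iff[OF y] u y by (simp add: sg_phase_def q_def L2_norm_def L2_inner_eq_ip)
      have "sg_gain u y * q = ip u y / (sqrt (ip u u) * sqrt (ip u u))"
        using pos ypos by (simp add: g q_def)
      then have "sg_gain u y * q = ip u y / ip u u" using pos by simp
      then show ?thesis
        using q pos ypos by (simp add: ph g power_divide arccos_lbound arccos_ubound abs_le_iff cos_arccos)
    qed
  qed
  show ?thesis
  proof
    assume "z \<in> scaled_graph (lti_response A B C D)"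
    then obtain u y s where z: "z = of_real (sg_gain u y) * exp (\<i> * of_real (s * sg_phase u y))"
      and u: "sq_int u" "\<not> L2_null u" and y: "sq_int y" and H: "lti_response A B C D u y"
      and s: "s \<in> {1, -1}"
      unfolding scaled_graph_def in_L2_iff_sq_int by auto
    have pos: "ip u u > 0" using u L2_null_iff[of u] ip_self_nonneg[of u] by simp
    note k = key[OF u(1) y pos]
    have "(cmod z)\<^sup>2 = (sg_gain u y)\<^sup>2"
      by (simp add: z norm_mult)
    moreover have "Re z = sg_gain u y * cos (sg_phase u y)"
      using s by (auto simp: z Re_exp)
    ultimately show ?R
      using k u y H pos unfolding response_pair_def by auto
  next
    assume ?R
    then obtain u y where u: "sq_int u" and y: "sq_int y" and H: "lti_response A B C D u y"
      and pos: "ip u u > 0" and z: "(cmod z)\<^sup>2 = ip y y / ip u u" "Re z = ip u y / ip u u"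
      unfolding response_pair_def by auto
    note k = key[OF u y pos]
    \<comment> \<open>The phase lies in \<open>[0, pi]\<close>, so the sign alone selects the
      half-plane of \<open>z\<close>.\<close>
    define s :: real where "s = (if Im z \<ge> 0 then 1 else -1)"
    define w where "w = of_real (sg_gain u y) * exp (\<i> * of_real (s * sg_phase u y))"
    have "Re w = Re z"
      using k z by (auto simp: w_def s_def Re_exp)
    moreover have "(cmod w)\<^sup>2 = (cmod z)\<^sup>2"
      using k z by (simp add: w_def norm_mult)
    ultimately have "(Im w)\<^sup>2 = (Im z)\<^sup>2"
      by (simp add: cmod_power2)
    then have "\<bar>Im w\<bar> = \<bar>Im z\<bar>" by (simp add: power2_eq_iff abs_eq_iff)
    moreover have "0 \<le> sg_gain u y * sin (sg_phase u y)"
      using k by (intro mult_nonneg_nonneg sin_ge_zero) auto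
    then have "s * Im w \<ge> 0"
      by (auto simp: w_def s_def Im_exp)
    ultimately have "Im w = Im z" by (auto simp: s_def split: if_splits)
    then have "z = w" using \<open>Re w = Re z\<close> by (simp add: complex_eq_iff)
    moreover have "\<not> L2_null u" using pos u by (simp add: L2_null_iff)
    ultimately show "z \<in> scaled_graph (lti_response A B C D)"
      using u y H unfolding scaled_graph_def in_L2_iff_sq_int w_def s_def
      by (intro CollectI exI[of _ u] exI[of _ y] exI[of _ "if Im z \<ge> 0 then 1 else -1"]) auto
  qed
qed

lemma scaled_graph_subset:
  fixes A :: "real^'m^'m" and B :: "real^'n^'m" and C :: "real^'m^'n" and D :: "real^'n^'n"
  assumes hw: "hurwitz A" and P: "symmetric_mat P" "neg_semidef (F_mat A B C D \<sigma> lc r P)"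
  shows "scaled_graph (lti_response A B C D) \<subseteq> S_region (Pi_mat \<sigma> lc r)"
proof
  fix z assume "z \<in> scaled_graph (lti_response A B C D)"
  then obtain u y where u: "sq_int u" and y: "sq_int y" and H: "lti_response A B C D u y"
      and pos: "ip u u > 0" and z: "(cmod z)\<^sup>2 = ip y y / ip u u" "Re z = ip u y / ip u u"
    unfolding scaled_graph_iff response_pair_def by auto
  obtain x where x: "lti_state A B 0 u x" "\<And>t. t \<ge> 0 \<Longrightarrow> y t = C *v x t + D *v u t"
    using H unfolding lti_response_def by auto
  have "0 \<le> integral {0..} (\<lambda>t. supply_rate \<sigma> lc r (y t) (u t))"
  proof (rule dissipation[OF x(1) lti_state_sq_int[OF hw u x(1)] u P(1)])
    show "(\<lambda>t. supply_rate \<sigma> lc r (y t) (u t)) absolutely_integrable_on {0..}"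
      using y u by (rule supply_integral)
    show "2 * (x t \<bullet> (P *v (A *v x t + B *v u t))) \<le> supply_rate \<sigma> lc r (y t) (u t)" if "t \<ge> 0" for t
      using P(2) x(2)[OF that] unfolding neg_semidef_F_mat_iff[OF P(1)] by simp
  qed
  then have "0 \<le> \<sigma> * (ip y y - 2 * lc * ip u y + (lc\<^sup>2 - r\<^sup>2) * ip u u)"
    by (simp add: supply_integral[OF y u])
  then have "0 \<le> \<sigma> * (ip y y - 2 * lc * ip u y + (lc\<^sup>2 - r\<^sup>2) * ip u u) / ip u u"
    using pos by simp
  also have "\<dots> = \<sigma> * ((cmod z)\<^sup>2 - 2 * lc * Re z + (lc\<^sup>2 - r\<^sup>2))"
    using pos by (simp add: z field_simps)
  finally show "z \<in> S_region (Pi_mat \<sigma> lc r)"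
    by (simp add: S_region_Pi_mat)
qed

section \<open>Switching between trajectories\<close>

lemma additive_bounded_above_linear:
  fixes f :: "real \<Rightarrow> real"
  assumes add: "\<And>s t. f (s + t) = f s + f t" and bdd: "\<And>t. \<bar>t\<bar> \<le> 1 \<Longrightarrow> f t \<le> K"
  shows "f t = t * f 1"
proof -
  \<comment> \<open>The deviation from linearity is additive and vanishes on the integers, hence is
    1-periodic and bounded above everywhere by its bound on \<open>[0, 1)\<close>. Since
    \<open>g (n t) = n g t\<close>, it cannot be positive, and being odd it is zero.\<close>
  define g where "g t = f t - t * f 1" for t
  have gadd: "g (s + t) = g s + g t" for s t by (simp add: g_def add algebra_simps)
  have gn: "g (real n * t) = real n * g t" for n t
  proof (induction n)
    case 0
    then show ?case using gadd[of 0 0] by simp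
  next
    case (Suc n)
    then show ?case using gadd[of t "real n * t"] by (simp add: algebra_simps)
  qed
  have g0: "g 0 = 0" using gadd[of 0 0] by simp
  have gneg: "g (- t) = - g t" for t using gadd[of t "- t"] g0 by simp
  have "g 1 = 0" by (simp add: g_def)
  then have gi: "g (real_of_int k) = 0" for k
    using gn[of "nat \<bar>k\<bar>" 1] gneg[of "real_of_int k"] by (cases "k \<ge> 0") auto
  have gK: "g t \<le> K + \<bar>f 1\<bar>" for t
  proof -
    have "g t = g (frac t)" using gadd[of "of_int \<lfloor>t\<rfloor>" "frac t"] gi by (simp add: frac_def)
    also have "\<dots> \<le> K + \<bar>f 1\<bar>"
    proof -
      have fr: "0 \<le> frac t" "frac t < 1" by (auto simp: frac_lt_1)
      then have "\<bar>frac t * f 1\<bar> \<le> 1 * \<bar>f 1\<bar>" unfolding abs_mult by (intro mult_right_mono) auto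
      then show ?thesis using bdd[of "frac t"] fr by (simp add: g_def)
    qed
    finally show ?thesis .
  qed
  have le: "g t \<le> 0" for t
  proof (rule ccontr)
    assume "\<not> g t \<le> 0"
    then have p: "g t > 0" by simp
    then obtain n :: nat where "K + \<bar>f 1\<bar> < real n * g t" using reals_Archimedean3 by blast
    then show False using gK[of "real n * t"] gn[of n t] by simp
  qed
  have "g t = 0" using le[of t] le[of "- t"] gneg[of t] by simp
  then show ?thesis by (simp add: g_def)
qed

text \<open>The Jordan-von Neumann argument for a function of arbitrary sign: the polarisation
  \<open>b\<close> is additive by the parallelogram law. Homogeneity would normally use continuity
  or positivity; here a bound from above along short segments replaces them.\<close>

lemma quadratic_form_of_parallelogram:
  fixes V :: "real^'m \<Rightarrow> real"
  assumes par: "\<And>x y. V (x + y) + V (x - y) = 2 * V x + 2 * V y"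
    and scale: "\<And>c x. V (c *\<^sub>R x) = c\<^sup>2 * V x"
    and bdd: "\<And>x y. \<exists>K. \<forall>t. \<bar>t\<bar> \<le> 1 \<longrightarrow> V (x + t *\<^sub>R y) \<le> K"
  shows "\<exists>P. symmetric_mat P \<and> (\<forall>x. V x = x \<bullet> (P *v x))"
proof -
  define b where "b x y = (V (x + y) - V (x - y)) / 4" for x y
  have neg: "V (- x) = V x" for x using scale[of "-1" x] by simp
  have bsym: "b x y = b y x" for x y
    using neg[of "x - y"] by (simp add: b_def add.commute)
  have half: "b (x + x') y + b (x - x') y = 2 * b x y" for x x' y
  proof -
    have "V (x + x' + y) + V (x - x' + y) = 2 * V (x + y) + 2 * V x'"
      using par[of "x + y" x'] by (simp add: algebra_simps)
    moreover have "V (x + x' - y) + V (x - x' - y) = 2 * V (x - y) + 2 * V x'"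
      using par[of "x - y" x'] by (simp add: algebra_simps)
    ultimately show ?thesis by (simp add: b_def field_simps)
  qed
  have b0: "b 0 y = 0" for y using neg[of y] by (simp add: b_def)
  have dbl: "b (2 *\<^sub>R x) y = 2 * b x y" for x y
    using half[of x x y] b0[of y] by (simp add: scaleR_2)
  have badd: "b (p + q) y = b p y + b q y" for p q y
  proof -
    \<comment> \<open>Any two vectors are sum and difference of their half-sum and half-difference,
      so \<open>half\<close> together with doubling gives additivity.\<close>
    have "(1/2) *\<^sub>R (p + q) + (1/2) *\<^sub>R (p - q) = p" "(1/2) *\<^sub>R (p + q) - (1/2) *\<^sub>R (p - q) = q"
      by (simp_all add: vec_eq_iff field_simps)
    then show ?thesis
      using half[of "(1/2) *\<^sub>R (p + q)" "(1/2) *\<^sub>R (p - q)" y] dbl[of "(1/2) *\<^sub>R (p + q)" y] by simp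
  qed
  have bscale: "b (c *\<^sub>R x) y = c * b x y" for c x y
  proof -
    obtain K where K: "\<And>t. \<bar>t\<bar> \<le> 1 \<Longrightarrow> V (y + t *\<^sub>R x) \<le> K" using bdd by blast
    have "b (t *\<^sub>R x) y \<le> (K + \<bar>V x\<bar> + \<bar>V y\<bar>) / 2" if t: "\<bar>t\<bar> \<le> 1" for t
    proof -
      have "V (t *\<^sub>R x + y) + V (t *\<^sub>R x - y) = 2 * (t\<^sup>2 * V x) + 2 * V y"
        using par[of "t *\<^sub>R x" y] scale by simp
      then have "4 * b (t *\<^sub>R x) y = 2 * V (y + t *\<^sub>R x) - 2 * (t\<^sup>2 * V x) - 2 * V y"
        by (simp add: b_def add.commute)
      moreover have "\<bar>t\<^sup>2\<bar> * \<bar>V x\<bar> \<le> 1 * \<bar>V x\<bar>"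
        using t by (intro mult_right_mono) (auto simp: abs_square_le_1)
      then have "- (t\<^sup>2 * V x) \<le> \<bar>V x\<bar>"
        using abs_ge_minus_self[of "t\<^sup>2 * V x"] unfolding abs_mult by (simp only: mult_1)
      ultimately show ?thesis
        using K[OF t] abs_ge_minus_self[of "V y"] by argo
    qed
    from additive_bounded_above_linear[where f="\<lambda>t. b (t *\<^sub>R x) y", OF _ this, of c]
    show ?thesis by (simp add: scaleR_left_distrib badd)
  qed
  have lin: "linear (\<lambda>x. b x y)" for y by (rule linearI) (auto simp: badd bscale)
  define f where "f y = (\<chi> i. b (axis i 1) y)" for y
  have "linear f"
    by (rule linearI) (auto simp: f_def vec_eq_iff bsym[of "axis _ 1"] badd bscale)
  have inner_f: "x \<bullet> f y = b x y" for x y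
  proof -
    have "b x y = b (\<Sum>i\<in>UNIV. (x $ i) *\<^sub>R axis i 1) y"
      using basis_expansion[of x] by (simp add: scalar_mult_eq_scaleR)
    also have "\<dots> = (\<Sum>i\<in>UNIV. x $ i * b (axis i 1) y)"
      by (simp add: linear_sum[OF lin] bscale)
    finally show ?thesis by (simp add: f_def inner_vec_def)
  qed
  define P where "P = matrix f"
  have P: "P *v y = f y" for y
    unfolding P_def using \<open>linear f\<close> by (simp add: matrix_works)
  have "V x = x \<bullet> (P *v x)" for x
    using scale[of 2 x] scale[of 0 x] by (simp add: P inner_f b_def scaleR_2)
  moreover have "symmetric_mat P"
    unfolding symmetric_mat_def
    by (auto simp: P_def matrix_def transpose_def vec_eq_iff f_def intro: bsym)
  ultimately show ?thesis by blast
qed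

text \<open>A smooth trajectory with prescribed initial state and input value, against which the
  value function is tested. It is the power series whose coefficients are the derivatives at time 0,
  divided by factorials.\<close>

lemma ex_constant_input_state:
  fixes A :: "real^'m^'m" and B :: "real^'n^'m"
  shows "\<exists>x. lti_state A B x0 (\<lambda>_. u0) x"
proof -
  define b where "b = B *v u0"
  \<comment> \<open>The derivatives at 0. The constant input enters only the first one.\<close>
  define a where "a = rec_nat x0 (\<lambda>n v. A *v v + (if n = 0 then b else 0))"
  have a0: "a 0 = x0" and aS: "a (Suc n) = A *v a n + (if n = 0 then b else 0)" for n
    by (simp_all add: a_def)
  obtain K where K: "K > 0" "\<And>v. norm (A *v v) \<le> norm v * K"
    using bounded_linear.pos_bounded[OF bounded_linear_matrix[of A]] by blast
  \<comment> \<open>The extra 1 absorbs the contribution of \<open>b\<close> in the inductive step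
    of the growth bound.\<close>
  define k where "k = K + 1"
  define M where "M = norm x0 + norm b"
  have bnd: "norm (a n) \<le> M * k ^ n" for n
  proof (induction n)
    case 0
    then show ?case by (simp add: a0 M_def)
  next
    case (Suc n)
    have "norm (a (Suc n)) \<le> norm (a n) * K + (if n = 0 then norm b else 0)"
      unfolding aS using K(2)[of "a n"] by (intro norm_triangle_le) auto
    also have "\<dots> \<le> M * k ^ n * K + M * k ^ n"
    proof (rule add_mono)
      show "norm (a n) * K \<le> M * k ^ n * K" using Suc K by simp
      show "(if n = 0 then norm b else 0) \<le> M * k ^ n" using K by (simp add: M_def k_def)
    qed
    also have "\<dots> = M * k ^ Suc n" by (simp add: k_def algebra_simps)
    finally show ?case .
  qed
  define c where "c i n = a n $ i / fact n" for i n
  have summ: "summable (\<lambda>n. c i n * t ^ n)" for i t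
  proof (rule summable_comparison_test)
    show "\<exists>N. \<forall>n\<ge>N. norm (c i n * t ^ n) \<le> M * ((k * \<bar>t\<bar>) ^ n /\<^sub>R fact n)"
    proof (intro exI allI impI)
      fix n
      have "\<bar>a n $ i\<bar> \<le> M * k ^ n" using component_le_norm_cart[of "a n" i] bnd[of n] by simp
      then have "\<bar>a n $ i\<bar> * (\<bar>t\<bar> ^ n / fact n) \<le> M * k ^ n * (\<bar>t\<bar> ^ n / fact n)"
        by (intro mult_right_mono) auto
      then show "norm (c i n * t ^ n) \<le> M * ((k * \<bar>t\<bar>) ^ n /\<^sub>R fact n)"
        by (simp add: c_def abs_mult power_abs power_mult_distrib divide_inverse mult_ac)
    qed
    show "summable (\<lambda>n. M * ((k * \<bar>t\<bar>) ^ n /\<^sub>R fact n))"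
      by (intro summable_mult summable_exp_generic)
  qed
  define x where "x t = (\<chi> i. \<Sum>n. c i n * t ^ n)" for t
  have sums: "(\<lambda>n. c i n * t ^ n) sums (x t $ i)" for i t
    using summ by (simp add: x_def summable_sums)
  have der: "((\<lambda>t. x t $ i) has_field_derivative ((A *v x t + B *v u0) $ i)) (at t)" for i t
  proof -
    have d: "diffs (c i) n = (\<Sum>j\<in>UNIV. A $ i $ j * c j n) + (if n = 0 then b $ i else 0)" for n
    proof -
      have "diffs (c i) n = a (Suc n) $ i / fact n"
        by (simp add: diffs_def c_def del: of_nat_Suc)
      then show ?thesis
        by (simp add: aS c_def matrix_vector_mult_def sum_divide_distrib add_divide_distrib)
    qed
    have "(\<lambda>n. (\<Sum>j\<in>UNIV. A $ i $ j * (c j n * t ^ n)) + (if n = 0 then b $ i else 0))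
        sums ((\<Sum>j\<in>UNIV. A $ i $ j * x t $ j) + b $ i)"
      by (intro sums_add sums_sum sums_mult sums) (use sums_single[of 0 "\<lambda>_. b $ i"] in simp)
    also have "(\<lambda>n. (\<Sum>j\<in>UNIV. A $ i $ j * (c j n * t ^ n)) + (if n = 0 then b $ i else 0))
        = (\<lambda>n. diffs (c i) n * t ^ n)"
      by (auto simp: d fun_eq_iff sum_distrib_left algebra_simps)
    finally have "(\<Sum>n. diffs (c i) n * t ^ n) = (A *v x t + B *v u0) $ i"
      by (simp add: sums_unique[symmetric] matrix_vector_mult_def b_def)
    moreover have "((\<lambda>t. \<Sum>n. c i n * t ^ n) has_field_derivative (\<Sum>n. diffs (c i) n * t ^ n)) (at t)"
      using summ by (rule termdiffs_strong_converges_everywhere)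
    ultimately show ?thesis by (simp add: x_def)
  qed
  have x0: "x 0 = x0"
    by (simp add: x_def vec_eq_iff powser_zero) (simp add: c_def a0)
  have "((\<lambda>s. A *v x s + B *v u0) has_integral (x t - x0)) {0..t}" if "t \<ge> 0" for t
  proof -
    have "((\<lambda>s. (A *v x s + B *v u0) $ i) has_integral (x t $ i - x 0 $ i)) {0..t}" for i
      using that der by (intro fundamental_theorem_of_calculus)
        (auto simp: has_real_derivative_iff_has_vector_derivative[symmetric]
          intro: has_field_derivative_at_within)
    then have "((\<lambda>s. (A *v x s + B *v u0) \<bullet> axis i 1) has_integral ((x t - x0) \<bullet> axis i 1)) {0..t}" for i
      by (simp add: inner_axis x0)
    then show ?thesis
      by (subst has_integral_componentwise_iff) (auto simp: Basis_vec_def)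
  qed
  then show ?thesis unfolding lti_state_def by blast
qed

section \<open>Concatenation of signals and trajectories; with the zero function first,
  delay\<close>

definition switch :: "real \<Rightarrow> (real \<Rightarrow> 'a) \<Rightarrow> (real \<Rightarrow> 'a) \<Rightarrow> real \<Rightarrow> 'a" where
  "switch T f g t = (if t < T then f t else g (t - T))"

lemma has_integral_switch_Icc:
  fixes f g :: "real \<Rightarrow> 'a::euclidean_space"
  assumes "0 \<le> T" "T \<le> t" "(f has_integral I) {0..T}" "(g has_integral J) {0..t - T}"
  shows "(switch T f g has_integral (I + J)) {0..t}"
proof (rule has_integral_combine[OF assms(1,2)])
  show "(switch T f g has_integral I) {0..T}"
    using assms(3) by (rule has_integral_spike_finite[of "{T}", rotated 2]) (auto simp: switch_def)
  have "((\<lambda>x. g (1 *\<^sub>R x + (- T))) has_integral (1 / \<bar>1\<bar> ^ DIM(real)) *\<^sub>R J)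
      ((\<lambda>x. (1/1) *\<^sub>R x + - ((1/1) *\<^sub>R (- T))) ` cbox 0 (t - T))"
    using assms(4) by (intro has_integral_affinity) auto
  moreover have "(\<lambda>x. x + T) ` {0..t - T} = {T..t}"
    using image_add_atLeastAtMost'[of T 0 "t - T"] by (simp add: add.commute)
  ultimately have "((\<lambda>s. g (s - T)) has_integral J) {T..t}"
    by (simp add: algebra_simps)
  then show "(switch T f g has_integral J) {T..t}"
    by (rule has_integral_eq[rotated]) (auto simp: switch_def)
qed

lemma integral_switch:
  fixes f g :: "real \<Rightarrow> 'a::euclidean_space"
  assumes T: "0 \<le> T" and f: "f absolutely_integrable_on {0..T}" and g: "g absolutely_integrable_on {0..}"
  shows "switch T f g absolutely_integrable_on {0..}"
    and "integral {0..} (switch T f g) = integral {0..T} f + integral {0..} g"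
proof -
  have im: "(\<lambda>t. t - T) ` {T..} = {0..}"
  proof
    show "{0..} \<subseteq> (\<lambda>t. t - T) ` {T..}"
    proof
      fix s :: real assume "s \<in> {0..}"
      then show "s \<in> (\<lambda>t. t - T) ` {T..}" by (intro image_eqI[of _ _ "s + T"]) auto
    qed
  qed auto
  have der: "((\<lambda>t. t - T) has_real_derivative 1) (at x within {T..})" for x
    by (auto intro!: derivative_eq_intros)
  have sh: "(\<lambda>t. g (t - T)) absolutely_integrable_on {T..}"
     "integral {T..} (\<lambda>t. g (t - T)) = integral {0..} g"
    using has_absolute_integral_change_of_variables_real[where S="{T..}" and g="\<lambda>t. t - T"
        and h="\<lambda>_. 1" and f=g and b="integral {0..} g"] g
    unfolding im by (simp_all add: der inj_on_def)
  have 1: "switch T f g absolutely_integrable_on {0..T}"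
    by (rule absolutely_integrable_spike[OF f, of "{T}"]) (auto simp: switch_def)
  have 2: "switch T f g absolutely_integrable_on {T..}"
    by (rule absolutely_integrable_spike[OF sh(1), of "{}"]) (auto simp: switch_def)
  have U: "{0..T} \<union> {T..} = {0..}" using T by auto
  show "switch T f g absolutely_integrable_on {0..}"
    using absolutely_integrable_Un[OF 1 2] by (simp add: U)
  have "(switch T f g has_integral (integral {0..T} (switch T f g) + integral {T..} (switch T f g))) ({0..T} \<union> {T..})"
  proof (rule has_integral_Un)
    have "{0..T} \<inter> {T..} = {T}" using T by auto
    then show "negligible ({0..T} \<inter> {T..})" by simp
  qed (use 1 2 in \<open>auto simp: absolutely_integrable_on_def integrable_integral\<close>)
  moreover have "integral {0..T} (switch T f g) = integral {0..T} f"
    by (rule integral_spike[of "{T}"]) (auto simp: switch_def)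
  moreover have "integral {T..} (switch T f g) = integral {T..} (\<lambda>t. g (t - T))"
    by (rule integral_cong) (auto simp: switch_def)
  ultimately show "integral {0..} (switch T f g) = integral {0..T} f + integral {0..} g"
    by (simp add: U sh integral_unique)
qed

text \<open>The first piece is constrained on \<open>{0..T}\<close> only, so that it may be a
  constant input, which is not square integrable on the half-line.\<close>

lemma sq_int_switch:
  fixes f g :: "real \<Rightarrow> 'a::euclidean_space"
  assumes T: "0 \<le> T" and f: "f \<in> borel_measurable (lebesgue_on {0..T})"
    and f2: "(\<lambda>t. (norm (f t))\<^sup>2) integrable_on {0..T}" and g: "sq_int g"
  shows "sq_int (switch T f g)"
proof -
  \<comment> \<open>Extension by zero moves measurability to the whole line, where translation is
    measurable.\<close>
  define F where "F t = (if t \<in> {0..T} then f t else 0)" for t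
  define G where "G t = (if t \<in> {0..} then g t else 0)" for t
  have ext: "(\<lambda>t. if t \<in> S then h t else 0) \<in> borel_measurable lebesgue"
    if "h \<in> borel_measurable (lebesgue_on S)" "S \<in> sets lebesgue" for h :: "real \<Rightarrow> 'a" and S
    using that borel_measurable_restrict_space_iff[of S lebesgue h]
    by (simp add: indicator_scaleR_eq_if)
  have F: "F \<in> borel_measurable lebesgue" and G: "G \<in> borel_measurable lebesgue"
    unfolding F_def G_def using f g by (intro ext; simp add: sq_int_def)+
  have "(\<lambda>t. - T + 1 * t) \<in> lebesgue \<rightarrow>\<^sub>M lebesgue"
    using lebesgue_affine_measurable[where c="\<lambda>x::real. 1" and t="-T"] by simp
  then have "(\<lambda>t. G (- T + 1 * t)) \<in> borel_measurable lebesgue"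
    using G by (rule measurable_compose)
  then have "(\<lambda>t. if t < T then F t else G (- T + 1 * t)) \<in> borel_measurable lebesgue"
    using F by (intro measurable_If) (auto simp: lessThan_def[symmetric])
  then have "(\<lambda>t. if t < T then F t else G (- T + 1 * t)) \<in> borel_measurable (lebesgue_on {0..})"
    by (rule measurable_restrict_space1)
  then have "switch T f g \<in> borel_measurable (lebesgue_on {0..})"
    by (subst measurable_cong[of _ _ "\<lambda>t. if t < T then F t else G (- T + 1 * t)"])
      (use T in \<open>auto simp: switch_def F_def G_def\<close>)
  moreover have "switch T (\<lambda>t. (norm (f t))\<^sup>2) (\<lambda>t. (norm (g t))\<^sup>2) absolutely_integrable_on {0..}"
    using f2 g by (intro integral_switch T nonnegative_absolutely_integrable_1) (auto simp: sq_int_def)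
  then have "switch T (\<lambda>t. (norm (f t))\<^sup>2) (\<lambda>t. (norm (g t))\<^sup>2) integrable_on {0..}"
    by (simp add: absolutely_integrable_on_def)
  moreover have "switch T (\<lambda>t. (norm (f t))\<^sup>2) (\<lambda>t. (norm (g t))\<^sup>2) = (\<lambda>t. (norm (switch T f g t))\<^sup>2)"
    by (simp add: switch_def fun_eq_iff)
  ultimately show ?thesis by (simp add: sq_int_def)
qed

lemma sq_int_on_Icc:
  assumes "sq_int f"
  shows "f \<in> borel_measurable (lebesgue_on {0..T})" "(\<lambda>t. (norm (f t))\<^sup>2) integrable_on {0..T}"
  using assms unfolding sq_int_def by (auto intro: measurable_restrict_mono integrable_on_subinterval)

lemma continuous_on_Icc_sq_int:
  fixes f :: "real \<Rightarrow> 'a::euclidean_space"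
  assumes "continuous_on {0..T} f"
  shows "f \<in> borel_measurable (lebesgue_on {0..T})" "(\<lambda>t. (norm (f t))\<^sup>2) integrable_on {0..T}"
  using assms by (auto intro!: continuous_imp_measurable_on_sets_lebesgue integrable_continuous_real
      continuous_intros)

lemma lti_state_switch:
  fixes A :: "real^'m^'m" and B :: "real^'n^'m"
  assumes T: "0 \<le> T" and 1: "lti_state A B x0 u1 x1" and 2: "lti_state A B (x1 T) u2 x2"
  shows "lti_state A B x0 (switch T u1 u2) (switch T x1 x2)"
  unfolding lti_state_def
proof (intro allI impI)
  fix t :: real assume t: "0 \<le> t"
  have eq: "(\<lambda>s. A *v switch T x1 x2 s + B *v switch T u1 u2 s) =
      switch T (\<lambda>s. A *v x1 s + B *v u1 s) (\<lambda>s. A *v x2 s + B *v u2 s)"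
    by (auto simp: switch_def fun_eq_iff)
  show "((\<lambda>s. A *v switch T x1 x2 s + B *v switch T u1 u2 s) has_integral (switch T x1 x2 t - x0)) {0..t}"
  proof (cases "t < T")
    case True
    have "((\<lambda>s. A *v x1 s + B *v u1 s) has_integral (x1 t - x0)) {0..t}"
      using 1 t by (simp add: lti_state_def)
    then show ?thesis
      unfolding eq using True by (auto simp: switch_def elim!: has_integral_eq[rotated])
  next
    case False
    have "(switch T (\<lambda>s. A *v x1 s + B *v u1 s) (\<lambda>s. A *v x2 s + B *v u2 s) has_integral
        ((x1 T - x0) + (x2 (t - T) - x1 T))) {0..t}"
      using 1 2 T False by (intro has_integral_switch_Icc) (auto simp: lti_state_def)
    then show ?thesis
      unfolding eq using False by (simp add: switch_def)
  qed
qed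

lemma lti_state_add:
  assumes "lti_state A B x0 u x" "lti_state A B z0 v z"
  shows "lti_state A B (x0 + z0) (\<lambda>t. u t + v t) (\<lambda>t. x t + z t)"
  unfolding lti_state_def
proof (intro allI impI)
  fix t :: real assume "0 \<le> t"
  then have "((\<lambda>s. (A *v x s + B *v u s) + (A *v z s + B *v v s)) has_integral ((x t - x0) + (z t - z0))) {0..t}"
    using assms by (intro has_integral_add) (auto simp: lti_state_def)
  then show "((\<lambda>s. A *v (x s + z s) + B *v (u s + v s)) has_integral (x t + z t - (x0 + z0))) {0..t}"
    by (simp add: matrix_vector_right_distrib algebra_simps)
qed

lemma lti_state_scaleR:
  fixes A :: "real^'m^'m" and B :: "real^'n^'m"
  assumes "lti_state A B x0 u x"
  shows "lti_state A B (c *\<^sub>R x0) (\<lambda>t. c *\<^sub>R u t) (\<lambda>t. c *\<^sub>R x t)"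
  unfolding lti_state_def
proof (intro allI impI)
  fix t :: real assume "0 \<le> t"
  then have "((\<lambda>s. c *\<^sub>R (A *v x s + B *v u s)) has_integral c *\<^sub>R (x t - x0)) {0..t}"
    using assms by (intro has_integral_cmul) (auto simp: lti_state_def)
  then show "((\<lambda>s. A *v (c *\<^sub>R x s) + B *v (c *\<^sub>R u s)) has_integral (c *\<^sub>R x t - c *\<^sub>R x0)) {0..t}"
    by (simp add: matrix_vector_mult_scaleR algebra_simps)
qed

lemma lti_state_zero: "lti_state A B 0 (\<lambda>_. 0) (\<lambda>_. 0)"
  by (simp add: lti_state_def)

section \<open>Separating a point from the scaled graph\<close>

lemma switch_zero_left: "switch T (\<lambda>_. 0) f t \<bullet> switch T (\<lambda>_. 0) g t = switch T (\<lambda>_. 0::real) (\<lambda>t. f t \<bullet> g t) t"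
  by (simp add: switch_def)

lemma sq_int_delay: "0 \<le> T \<Longrightarrow> sq_int g \<Longrightarrow> sq_int (switch T (\<lambda>_. 0) g)"
  by (rule sq_int_switch) (auto intro: integrable_0)

lemma ip_delay:
  assumes "0 \<le> T" "sq_int f" "sq_int g"
  shows "ip (switch T (\<lambda>_. 0) f) (switch T (\<lambda>_. 0) g) = ip f g"
proof -
  have "integral {0..} (switch T (\<lambda>_. 0) (\<lambda>t. f t \<bullet> g t)) = integral {0..} (\<lambda>t. f t \<bullet> g t)"
    using integral_switch(2)[of T "\<lambda>_. 0" "\<lambda>t. f t \<bullet> g t"] assms sq_int_inner[of f g] by simp
  then show ?thesis by (simp add: ip_def switch_zero_left)
qed

text \<open>The delayed signal meets only the tail of \<open>f\<close>. Young's inequality with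
  weight \<open>e\<close> bounds the product by the tail energy over \<open>e\<close> plus
  \<open>e\<close> times the energy of \<open>g\<close>; \<open>e\<close> is fixed first, the delay
  grows afterwards.\<close>

lemma ip_delay_tendsto_0:
  fixes f g :: "real \<Rightarrow> 'a::euclidean_space"
  assumes f: "sq_int f" and g: "sq_int g"
  shows "(\<lambda>n. ip f (switch (real n) (\<lambda>_. 0) g)) \<longlonglongrightarrow> 0"
proof (rule tendstoI)
  fix \<epsilon> :: real assume \<epsilon>: "\<epsilon> > 0"
  define e where "e = \<epsilon> / (2 * (ip g g + 1))"
  have g0: "0 \<le> ip g g" by (rule ip_self_nonneg)
  have e: "e > 0" using \<epsilon> g0 by (simp add: e_def)
  have eg: "e * ip g g < \<epsilon> / 2" using \<epsilon> g0 by (simp add: e_def field_simps)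
  define q where "q t = f t \<bullet> f t" for t
  have qa: "q absolutely_integrable_on {0..}" unfolding q_def using f f by (rule sq_int_inner)
  have qT: "q absolutely_integrable_on {0..T}" for T
    using qa by (rule absolutely_integrable_on_subinterval) auto
  have bound: "\<bar>ip f (switch T (\<lambda>_. 0) g)\<bar> \<le> (1/e) * (ip f f - integral {0..T} q) + e * ip g g"
    if T: "0 \<le> T" for T
  proof -
    define h where "h = switch T (\<lambda>_. 0) g"
    have h: "sq_int h" unfolding h_def using T g by (rule sq_int_delay)
    \<comment> \<open>The energy density of \<open>f\<close> cut off after \<open>T\<close>, so that
      \<open>q - p\<close> is its tail.\<close>
    define p where "p = switch T q (\<lambda>_. 0)"
    have p: "p absolutely_integrable_on {0..}" "integral {0..} p = integral {0..T} q"
      using integral_switch[OF T qT, of "\<lambda>_. 0"] by (auto simp: p_def)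
    have "norm (integral {0..} (\<lambda>t. f t \<bullet> h t)) \<le> integral {0..} (\<lambda>t. (1/e) * (q t - p t) + e * (h t \<bullet> h t))"
    proof (rule integral_norm_bound_integral)
      show "(\<lambda>t. f t \<bullet> h t) integrable_on {0..}" using f h by (rule integrable_inner)
      show "(\<lambda>t. (1/e) * (q t - p t) + e * (h t \<bullet> h t)) integrable_on {0..}"
        using qa p(1) integrable_inner[OF h h]
        by (intro integrable_add integrable_on_mult_right integrable_diff) (auto simp: absolutely_integrable_on_def)
      fix t
      show "norm (f t \<bullet> h t) \<le> (1/e) * (q t - p t) + e * (h t \<bullet> h t)"
      proof (cases "t < T")
        case True
        then show ?thesis by (simp add: h_def p_def switch_def)
      next
        case False
        have "\<bar>f t \<bullet> h t\<bar> \<le> norm (f t) * norm (h t)" by (rule Cauchy_Schwarz_ineq2)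
        also have "\<dots> \<le> (1/e) * (norm (f t))\<^sup>2 + e * (norm (h t))\<^sup>2"
        proof -
          have "0 \<le> (norm (f t) - e * norm (h t))\<^sup>2 / e" using e by simp
          also have "\<dots> = (1/e) * (norm (f t))\<^sup>2 + e * (norm (h t))\<^sup>2 - 2 * (norm (f t) * norm (h t))"
            using e by (simp add: field_simps power2_eq_square)
          finally show ?thesis
            using mult_nonneg_nonneg[OF norm_ge_zero[of "f t"] norm_ge_zero[of "h t"]] by linarith
        qed
        finally show ?thesis using False by (simp add: p_def switch_def q_def power2_norm_eq_inner)
      qed
    qed
    also have "integral {0..} (\<lambda>t. (1/e) * (q t - p t) + e * (h t \<bullet> h t))
        = (1/e) * (ip f f - integral {0..T} q) + e * ip h h"
    proof (rule integral_unique)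
      show "((\<lambda>t. (1/e) * (q t - p t) + e * (h t \<bullet> h t)) has_integral
          ((1/e) * (ip f f - integral {0..T} q) + e * ip h h)) {0..}"
        unfolding p(2)[symmetric] ip_def q_def[symmetric]
        using qa p(1) integrable_inner[OF h h]
        by (intro has_integral_add has_integral_mult_right has_integral_diff integrable_integral)
          (auto simp: absolutely_integrable_on_def)
    qed
    also have "ip h h = ip g g" unfolding h_def using T g g by (rule ip_delay)
    finally show ?thesis by (simp add: ip_def h_def)
  qed
  have "((\<lambda>T. (1/e) * (ip f f - integral {0..T} q)) \<longlongrightarrow> (1/e) * (ip f f - ip f f)) at_top"
    using integral_tendsto_at_top[OF qa] unfolding ip_def q_def[symmetric] by (intro tendsto_intros)
  then have "((\<lambda>T. (1/e) * (ip f f - integral {0..T} q)) \<longlongrightarrow> 0) at_top" by simp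
  then have "\<forall>\<^sub>F T in at_top. (1/e) * (ip f f - integral {0..T} q) < \<epsilon> / 2"
    by (rule order_tendstoD) (use \<epsilon> in simp)
  then have "\<forall>\<^sub>F n in sequentially. (1/e) * (ip f f - integral {0..real n} q) < \<epsilon> / 2"
    by (rule eventually_compose_filterlim[OF _ filterlim_real_sequentially])
  then show "\<forall>\<^sub>F n in sequentially. dist (ip f (switch (real n) (\<lambda>_. 0) g)) 0 < \<epsilon>"
  proof eventually_elim
    case (elim n)
    have "\<bar>ip f (switch (real n) (\<lambda>_. 0) g)\<bar> < \<epsilon>"
      using bound[of "real n"] eg elim by linarith
    then show ?case by simp
  qed
qed

lemma response_pair_add:
  assumes "response_pair A B C D u y" "response_pair A B C D v z"
  shows "response_pair A B C D (\<lambda>t. u t + v t) (\<lambda>t. y t + z t)"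
proof -
  obtain x x' where x: "lti_state A B 0 u x" "\<forall>t\<ge>0. y t = C *v x t + D *v u t"
    and x': "lti_state A B 0 v x'" "\<forall>t\<ge>0. z t = C *v x' t + D *v v t"
    using assms unfolding response_pair_def lti_response_def by blast
  have "lti_state A B 0 (\<lambda>t. u t + v t) (\<lambda>t. x t + x' t)"
    using lti_state_add[OF x(1) x'(1)] by simp
  then show ?thesis
    using assms x(2) x'(2) unfolding response_pair_def lti_response_def
    by (auto intro!: sq_int_add exI[of _ "\<lambda>t. x t + x' t"] simp: matrix_vector_right_distrib algebra_simps)
qed

lemma response_pair_scaleR:
  fixes A :: "real^'m^'m" and B :: "real^'n^'m"
  assumes "response_pair A B C D u y"
  shows "response_pair A B C D (\<lambda>t. c *\<^sub>R u t) (\<lambda>t. c *\<^sub>R y t)"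
proof -
  obtain x where x: "lti_state A B 0 u x" "\<forall>t\<ge>0. y t = C *v x t + D *v u t"
    using assms unfolding response_pair_def lti_response_def by blast
  have "lti_state A B 0 (\<lambda>t. c *\<^sub>R u t) (\<lambda>t. c *\<^sub>R x t)"
    using lti_state_scaleR[OF x(1), of c] by simp
  then show ?thesis
    using assms x(2) unfolding response_pair_def lti_response_def
    by (auto intro!: sq_int_scaleR exI[of _ "\<lambda>t. c *\<^sub>R x t"] simp: matrix_vector_mult_scaleR scaleR_right_distrib)
qed

text \<open>The system starts at rest, so it may wait at the zero state before the trajectory
  begins.\<close>

lemma response_pair_delay:
  fixes A :: "real^'m^'m" and B :: "real^'n^'m"
  assumes T: "0 \<le> T" and "response_pair A B C D u y"
  shows "response_pair A B C D (switch T (\<lambda>_. 0) u) (switch T (\<lambda>_. 0) y)"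
proof -
  obtain x where x: "lti_state A B 0 u x" "\<forall>t\<ge>0. y t = C *v x t + D *v u t"
    using assms unfolding response_pair_def lti_response_def by blast
  have "lti_state A B 0 (switch T (\<lambda>_. 0) u) (switch T (\<lambda>_. 0) x)"
    using lti_state_switch[OF T lti_state_zero x(1)] .
  then show ?thesis
    using assms x(2) unfolding response_pair_def lti_response_def
    by (auto intro!: sq_int_delay exI[of _ "switch T (\<lambda>_. 0) x"] simp: switch_def)
qed

text \<open>The map \<open>z \<mapsto> (\<bar>z\<bar>\<^sup>2, Re z)\<close> turns circles centred on the real axis into lines. In these
  coordinates the scaled graph is the section of this cone at first component 1.\<close>

definition gram_cone ::
  "real^'m^'m \<Rightarrow> real^'n^'m \<Rightarrow> real^'m^'n \<Rightarrow> real^'n^'n \<Rightarrow> (real \<times> real \<times> real) set" where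
  "gram_cone A B C D = {(ip u u, ip y y, ip u y) | u y. response_pair A B C D u y}"

text \<open>Delaying the second input makes it asymptotically orthogonal to the first input and the first
  output, so that the Gram data add up in the limit.\<close>

lemma gram_cone_add_closure:
  fixes A :: "real^'m^'m" and B :: "real^'n^'m" and C :: "real^'m^'n" and D :: "real^'n^'n"
  assumes "k \<in> gram_cone A B C D" "l \<in> gram_cone A B C D"
  shows "k + l \<in> closure (gram_cone A B C D)"
proof -
  obtain u y where k: "k = (ip u u, ip y y, ip u y)" and 1: "response_pair A B C D u y"
    using assms unfolding gram_cone_def by blast
  obtain v z where l: "l = (ip v v, ip z z, ip v z)" and 2: "response_pair A B C D v z"
    using assms unfolding gram_cone_def by blast
  note sq = 1[unfolded response_pair_def] 2[unfolded response_pair_def]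
  define S where "S n f = switch (real n) (\<lambda>_. 0) f" for n :: nat and f :: "real \<Rightarrow> real^'n"
  have S: "sq_int (S n f)" if "sq_int f" for n f using that by (simp add: S_def sq_int_delay)
  have SS: "ip (S n f) (S n g) = ip f g" if "sq_int f" "sq_int g" for n f g
    using that by (simp add: S_def ip_delay)
  have lim: "(\<lambda>n. ip f (S n g)) \<longlonglongrightarrow> 0" if "sq_int f" "sq_int g" for f g
    using that by (simp add: S_def ip_delay_tendsto_0)
  have expand: "ip (\<lambda>t. f t + S n g t) (\<lambda>t. f' t + S n g' t) = ip f f' + ip f (S n g') + ip f' (S n g) + ip g g'"
    if "sq_int f" "sq_int g" "sq_int f'" "sq_int g'" for f g f' g' n
    using that S by (simp add: ip_add_left ip_add_right sq_int_add SS ip_commute[of "S n g" f'])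
  have lim2: "(\<lambda>n. ip (\<lambda>t. f t + S n g t) (\<lambda>t. f' t + S n g' t)) \<longlonglongrightarrow> ip f f' + ip g g'"
    if "sq_int f" "sq_int g" "sq_int f'" "sq_int g'" for f g f' g'
  proof -
    have "(\<lambda>n. ip f f' + ip f (S n g') + ip f' (S n g) + ip g g') \<longlonglongrightarrow> ip f f' + 0 + 0 + ip g g'"
      using that by (intro tendsto_intros lim)
    then show ?thesis using that by (simp add: expand)
  qed
  define s where "s n = (ip (\<lambda>t. u t + S n v t) (\<lambda>t. u t + S n v t),
      ip (\<lambda>t. y t + S n z t) (\<lambda>t. y t + S n z t), ip (\<lambda>t. u t + S n v t) (\<lambda>t. y t + S n z t))" for n
  have "s n \<in> gram_cone A B C D" for n
    unfolding gram_cone_def s_def S_def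
    using response_pair_add[OF 1 response_pair_delay[of "real n", OF _ 2]] by auto
  moreover have "s \<longlonglongrightarrow> k + l"
    unfolding s_def k l plus_prod_def fst_conv snd_conv using sq by (intro tendsto_Pair lim2) auto
  ultimately show ?thesis unfolding closure_sequential by blast
qed

lemma closure_gram_cone_add:
  assumes "k \<in> closure (gram_cone A B C D)" "l \<in> closure (gram_cone A B C D)"
  shows "k + l \<in> closure (gram_cone A B C D)"
proof -
  obtain a b where a: "\<And>n. a n \<in> gram_cone A B C D" "a \<longlonglongrightarrow> k"
    and b: "\<And>n. b n \<in> gram_cone A B C D" "b \<longlonglongrightarrow> l"
    using assms unfolding closure_sequential by blast
  have "(\<lambda>n. a n + b n) \<longlonglongrightarrow> k + l" using a b by (intro tendsto_add)
  moreover have "a n + b n \<in> closure (gram_cone A B C D)" for n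
    using a b by (intro gram_cone_add_closure)
  ultimately show ?thesis
    by (rule closed_sequentially[OF closed_closure, rotated])
qed

lemma closure_gram_cone_scaleR:
  assumes "k \<in> closure (gram_cone A B C D)" "0 \<le> c"
  shows "c *\<^sub>R k \<in> closure (gram_cone A B C D)"
proof -
  have sc: "c *\<^sub>R k \<in> gram_cone A B C D" if k: "k \<in> gram_cone A B C D" for k
  proof -
    obtain u y where k: "k = (ip u u, ip y y, ip u y)" and 1: "response_pair A B C D u y"
      using k unfolding gram_cone_def by blast
    have "c *\<^sub>R k = (ip (\<lambda>t. sqrt c *\<^sub>R u t) (\<lambda>t. sqrt c *\<^sub>R u t),
        ip (\<lambda>t. sqrt c *\<^sub>R y t) (\<lambda>t. sqrt c *\<^sub>R y t), ip (\<lambda>t. sqrt c *\<^sub>R u t) (\<lambda>t. sqrt c *\<^sub>R y t))"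
      using assms(2) by (simp add: k ip_scaleR_left ip_scaleR_right)
    then show ?thesis
      unfolding gram_cone_def using response_pair_scaleR[OF 1, of "sqrt c"] by blast
  qed
  obtain a where a: "\<And>n. a n \<in> gram_cone A B C D" "a \<longlonglongrightarrow> k"
    using assms unfolding closure_sequential by blast
  have "(\<lambda>n. c *\<^sub>R a n) \<longlonglongrightarrow> c *\<^sub>R k" using a by (intro tendsto_intros)
  then show ?thesis
    unfolding closure_sequential using sc a(1) by (intro exI[of _ "\<lambda>n. c *\<^sub>R a n"]) simp
qed

text \<open>Approximating Gram data are divided by their first component, which is eventually
  positive, and turned back into complex numbers. Cauchy-Schwarz keeps the radicand
  nonnegative.\<close>

lemma closure_scaled_graph_of_gram:
  fixes A :: "real^'m^'m" and B :: "real^'n^'m" and C :: "real^'m^'n" and D :: "real^'n^'n"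
  assumes "(1, (cmod z)\<^sup>2, Re z) \<in> closure (gram_cone A B C D)"
  shows "z \<in> closure (scaled_graph (lti_response A B C D))"
proof -
  obtain k where k: "\<And>n. k n \<in> gram_cone A B C D" "k \<longlonglongrightarrow> (1, (cmod z)\<^sup>2, Re z)"
    using assms unfolding closure_sequential by blast
  have lim: "(\<lambda>n. fst (k n)) \<longlonglongrightarrow> 1" "(\<lambda>n. fst (snd (k n))) \<longlonglongrightarrow> (cmod z)\<^sup>2"
    "(\<lambda>n. snd (snd (k n))) \<longlonglongrightarrow> Re z"
    using tendsto_fst[OF k(2)] tendsto_fst[OF tendsto_snd[OF k(2)]] tendsto_snd[OF tendsto_snd[OF k(2)]]
    by simp_all
  define m where "m n = fst (snd (k n)) / fst (k n)" for n
  define p where "p n = snd (snd (k n)) / fst (k n)" for n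
  \<comment> \<open>Chooses the half-plane of \<open>z\<close>, so that the points converge to
    \<open>z\<close> and not to its conjugate.\<close>
  define s :: real where "s = (if Im z \<ge> 0 then 1 else -1)"
  define w where "w n = Complex (p n) (s * sqrt (m n - (p n)\<^sup>2))" for n
  have "m \<longlonglongrightarrow> (cmod z)\<^sup>2 / 1" "p \<longlonglongrightarrow> Re z / 1"
    unfolding m_def p_def using lim by (intro tendsto_divide; simp)+
  then have "w \<longlonglongrightarrow> Complex (Re z) (s * sqrt ((cmod z)\<^sup>2 - (Re z)\<^sup>2))"
    unfolding w_def by (intro tendsto_Complex tendsto_intros) auto
  also have "Complex (Re z) (s * sqrt ((cmod z)\<^sup>2 - (Re z)\<^sup>2)) = z"
    by (simp add: complex_eq_iff cmod_power2 s_def)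
  finally have "w \<longlonglongrightarrow> z" .
  moreover have "\<forall>\<^sub>F n in sequentially. 0 < fst (k n)"
    using lim(1) by (rule order_tendstoD) simp
  then have "\<forall>\<^sub>F n in sequentially. w n \<in> closure (scaled_graph (lti_response A B C D))"
  proof eventually_elim
    case (elim n)
    obtain u y where kn: "k n = (ip u u, ip y y, ip u y)" and R: "response_pair A B C D u y"
      using k(1)[of n] unfolding gram_cone_def by blast
    have pos: "ip u u > 0" using elim kn by simp
    have "(ip u y)\<^sup>2 \<le> ip u u * ip y y"
      using R pos by (intro ip_Cauchy_Schwarz) (auto simp: response_pair_def)
    then have "(p n)\<^sup>2 \<le> m n"
      using pos by (simp add: p_def m_def kn field_simps power2_eq_square)
    then have "(cmod (w n))\<^sup>2 = m n"
      by (auto simp: w_def cmod_power2 power_mult_distrib s_def)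
    then have "w n \<in> scaled_graph (lti_response A B C D)"
      unfolding scaled_graph_iff using R pos
      by (intro exI[of _ u] exI[of _ y]) (simp add: m_def p_def kn w_def)
    then show ?case using closure_subset by blast
  qed
  ultimately show ?thesis
    using Lim_in_closed_set[OF closed_closure] by (metis sequentially_bot)
qed

text \<open>A plane that strictly separates a point from a closed convex cone can be moved to the
  origin: \<open>b < 0\<close> because the cone contains zero, and the functional is nonnegative on
  the cone by scaling.\<close>

lemma gram_cone_separation:
  fixes A :: "real^'m^'m" and B :: "real^'n^'m" and C :: "real^'m^'n" and D :: "real^'n^'n"
  assumes "z \<notin> closure (scaled_graph (lti_response A B C D))"
  shows "\<exists>a0 a1 a2. a0 + a1 * (cmod z)\<^sup>2 + a2 * Re z < 0 \<and>
    (\<forall>u y. response_pair A B C D u y \<longrightarrow> 0 \<le> a0 * ip u u + a1 * ip y y + a2 * ip u y)"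
proof -
  define K where "K = closure (gram_cone A B C D)"
  have sc: "c *\<^sub>R k \<in> K" if "k \<in> K" "0 \<le> c" for c k
    using that closure_gram_cone_scaleR unfolding K_def by blast
  have "convex K"
    using sc closure_gram_cone_add unfolding K_def by (intro convexI) blast
  moreover have "closed K" by (simp add: K_def)
  moreover have "(1, (cmod z)\<^sup>2, Re z) \<notin> K"
    using assms closure_scaled_graph_of_gram unfolding K_def by blast
  ultimately have "\<exists>a b. a \<bullet> (1, (cmod z)\<^sup>2, Re z) < b \<and> (\<forall>k\<in>K. b < a \<bullet> k)"
    by (rule separating_hyperplane_closed_point)
  then obtain a b where ab: "a \<bullet> (1, (cmod z)\<^sup>2, Re z) < b" "\<And>k. k \<in> K \<Longrightarrow> b < a \<bullet> k"
    by blast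
  have "response_pair A B C D (\<lambda>_. 0) (\<lambda>_. 0)"
    unfolding response_pair_def lti_response_def using lti_state_zero by (auto intro!: exI[of _ "\<lambda>_. 0"])
  then have "(0, 0, 0) \<in> gram_cone A B C D"
    unfolding gram_cone_def by (force simp: ip_def)
  then have "b < 0"
    using ab(2)[of "(0, 0, 0)"] closure_subset unfolding K_def by (auto simp: inner_prod_def)
  have nonneg: "0 \<le> a \<bullet> k" if k: "k \<in> K" for k
  proof (rule ccontr)
    assume "\<not> 0 \<le> a \<bullet> k"
    then have neg: "a \<bullet> k < 0" by simp
    \<comment> \<open>The factor scales \<open>k\<close> to a cone element at which the functional
      equals \<open>b\<close>, against strict separation.\<close>
    then have "b < a \<bullet> ((b / (a \<bullet> k)) *\<^sub>R k)"
      using \<open>b < 0\<close> by (intro ab(2) sc k) (simp add: divide_nonpos_neg)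
    then show False using neg by simp
  qed
  have "0 \<le> fst a * ip u u + fst (snd a) * ip y y + snd (snd a) * ip u y"
    if "response_pair A B C D u y" for u y
  proof -
    have "(ip u u, ip y y, ip u y) \<in> gram_cone A B C D"
      unfolding gram_cone_def using that by blast
    then have "(ip u u, ip y y, ip u y) \<in> K"
      unfolding K_def by (rule subsetD[OF closure_subset])
    from nonneg[OF this] show ?thesis by (simp add: inner_prod_def)
  qed
  moreover have "fst a + fst (snd a) * (cmod z)\<^sup>2 + snd (snd a) * Re z < 0"
    using ab(1) \<open>b < 0\<close> by (simp add: inner_prod_def)
  ultimately show ?thesis by blast
qed

text \<open>Dividing by the size of \<open>a1\<close> and completing the square turns the functional
  into a circle, with the sign of \<open>a1\<close> as \<open>\<sigma>\<close>. What needs work is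
  \<open>a1 = 0\<close>, where the circle degenerates to a line, and positivity of the
  radius.\<close>

lemma scaled_graph_separating_circle:
  fixes A :: "real^'m^'m" and B :: "real^'n^'m" and C :: "real^'m^'n" and D :: "real^'n^'n"
  assumes "z \<notin> closure (scaled_graph (lti_response A B C D))"
  shows "\<exists>\<sigma> lc r. \<sigma> \<in> {1, -1} \<and> r > 0 \<and> \<sigma> * ((cmod z)\<^sup>2 - 2 * lc * Re z + (lc\<^sup>2 - r\<^sup>2)) < 0 \<and>
    (\<forall>u y. response_pair A B C D u y \<longrightarrow> 0 \<le> \<sigma> * (ip y y - 2 * lc * ip u y + (lc\<^sup>2 - r\<^sup>2) * ip u u))"
proof -
  obtain a0 a1 a2 where z: "a0 + a1 * (cmod z)\<^sup>2 + a2 * Re z < 0"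
    and R: "\<And>u y. response_pair A B C D u y \<Longrightarrow> 0 \<le> a0 * ip u u + a1 * ip y y + a2 * ip u y"
    using gram_cone_separation[OF assms] by blast
  have dist: "(cmod z)\<^sup>2 - 2 * l * Re z + l\<^sup>2 = (Re z - l)\<^sup>2 + (Im z)\<^sup>2" for l
    by (simp only: cmod_power2) (simp add: power2_eq_square algebra_simps)
  show ?thesis
  proof (cases "a1 \<ge> 0")
    case True
    define q where "q = a0 + a1 * (cmod z)\<^sup>2 + a2 * Re z"
    \<comment> \<open>Adding \<open>d\<close> to \<open>a1\<close> makes it positive. The extra term
      is nonnegative on all pairs and costs at most half of the slack at \<open>z\<close>.\<close>
    define d where "d = - q / (2 * ((cmod z)\<^sup>2 + 1))"
    have den: "(cmod z)\<^sup>2 + 1 > 0" by (rule add_nonneg_pos) auto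
    have d: "d > 0" using z den unfolding d_def q_def[symmetric] by (intro divide_pos_pos) auto
    have "d * (cmod z)\<^sup>2 \<le> d * ((cmod z)\<^sup>2 + 1)" using d by (intro mult_left_mono) auto
    also have "\<dots> = - q / 2" using den unfolding d_def by (simp add: field_simps)
    finally have "d * (cmod z)\<^sup>2 \<le> - q / 2" .
    then have z': "a0 + (a1 + d) * (cmod z)\<^sup>2 + a2 * Re z < 0"
      using z by (simp add: q_def algebra_simps)
    define p where "p = a1 + d"
    have p: "p > 0" using True d by (simp add: p_def)
    define lc where "lc = - a2 / (2 * p)"
    have a2: "a2 = - 2 * lc * p" using p by (simp add: lc_def)
    have neg: "(cmod z)\<^sup>2 - 2 * lc * Re z + a0 / p < 0"
    proof -
      have "p * ((cmod z)\<^sup>2 - 2 * lc * Re z + a0 / p) < 0"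
        using z' p unfolding p_def[symmetric] a2 by (simp add: algebra_simps)
      then show ?thesis using p by (simp add: mult_less_0_iff)
    qed
    \<comment> \<open>The squared radius is positive because it strictly exceeds the squared
      distance of \<open>z\<close> from the centre.\<close>
    have r2: "lc\<^sup>2 - a0 / p > 0" using neg dist[of lc] sum_power2_ge_zero[of "Re z - lc" "Im z"] by linarith
    define r where "r = sqrt (lc\<^sup>2 - a0 / p)"
    have r: "r > 0" "lc\<^sup>2 - r\<^sup>2 = a0 / p" using r2 by (auto simp: r_def)
    have "0 \<le> ip y y - 2 * lc * ip u y + (a0 / p) * ip u u" if "response_pair A B C D u y" for u y
    proof -
      have "0 \<le> a0 * ip u u + (a1 + d) * ip y y + a2 * ip u y"
        using R[OF that] mult_nonneg_nonneg[OF less_imp_le[OF d] ip_self_nonneg[of y]]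
        by (simp add: distrib_right)
      also have "\<dots> = p * (ip y y - 2 * lc * ip u y + (a0 / p) * ip u u)"
        using p unfolding p_def[symmetric] a2 by (simp add: algebra_simps)
      finally show ?thesis using p by (simp add: zero_le_mult_iff)
    qed
    then show ?thesis
      using neg r by (intro exI[of _ 1] exI[of _ lc] exI[of _ r]) simp
  next
    case False
    define p where "p = - a1"
    have p: "p > 0" using False by (simp add: p_def)
    define lc where "lc = a2 / (2 * p)"
    have a2: "a2 = 2 * lc * p" and a1: "a1 = - p" using p by (auto simp: lc_def p_def)
    \<comment> \<open>\<open>c\<close> is the squared radius that the plane dictates, possibly not
      positive; \<open>g\<close> is the squared distance of \<open>z\<close> from the
      centre.\<close>
    define c where "c = lc\<^sup>2 + a0 / p"
    define g where "g = (cmod z)\<^sup>2 - 2 * lc * Re z + lc\<^sup>2"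
    have g0: "g \<ge> 0" by (simp add: g_def dist)
    have gc: "g > c"
    proof -
      have "p * (- (cmod z)\<^sup>2 + 2 * lc * Re z + a0 / p) < 0"
        using z p unfolding a1 a2 by (simp add: algebra_simps)
      then have "- (cmod z)\<^sup>2 + 2 * lc * Re z + a0 / p < 0" using p by (simp add: mult_less_0_iff)
      then show ?thesis by (simp add: g_def c_def)
    qed
    have Rc: "ip y y - 2 * lc * ip u y + lc\<^sup>2 * ip u u \<le> c * ip u u" if "response_pair A B C D u y" for u y
    proof -
      have "0 \<le> p * (- ip y y + 2 * lc * ip u y + (a0 / p) * ip u u)"
        using R[OF that] p unfolding a1 a2 by (simp add: algebra_simps)
      then have "0 \<le> - ip y y + 2 * lc * ip u y + (a0 / p) * ip u u" using p by (simp add: zero_le_mult_iff)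
      then show ?thesis by (simp add: c_def algebra_simps)
    qed
    show ?thesis
    proof (cases "g = 0")
      \<comment> \<open>A disk contains its centre, so it cannot exclude \<open>z = lc\<close>; but \<open>c < 0\<close> forces all inputs to vanish.\<close>
      case True
      \<comment> \<open>Radius 1 is arbitrary: any positive one puts the centre \<open>z\<close>
        inside the excluded open disk.\<close>
      have "0 \<le> ip y y - 2 * lc * ip u y + (lc\<^sup>2 - 1\<^sup>2) * ip u u" if ry: "response_pair A B C D u y" for u y
      proof -
        have "sq_int u" "sq_int y" using ry by (auto simp: response_pair_def)
        then have "ip (\<lambda>t. y t + (- lc) *\<^sub>R u t) (\<lambda>t. y t + (- lc) *\<^sub>R u t)
            = ip y y - 2 * lc * ip u y + lc\<^sup>2 * ip u u"
          by (simp only: ip_add_left ip_add_right sq_int_add sq_int_scaleR ip_scaleR_left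
              ip_scaleR_right ip_commute[of y u]) (simp add: power2_eq_square algebra_simps)
        then have sq: "0 \<le> ip y y - 2 * lc * ip u y + lc\<^sup>2 * ip u u"
          using ip_self_nonneg[of "\<lambda>t. y t + (- lc) *\<^sub>R u t"] by simp
        then have "0 \<le> c * ip u u" using Rc[OF ry] by linarith
        then have "ip u u = 0" using gc True ip_self_nonneg[of u] by (simp add: zero_le_mult_iff)
        then show ?thesis using sq by simp
      qed
      then show ?thesis using True
        by (intro exI[of _ 1] exI[of _ lc] exI[of _ 1]) (simp add: g_def)
    next
      case False
      \<comment> \<open>A positive squared radius with \<open>c \<le> r^2 < g\<close>: enlarging the
        disk keeps all pairs in it, and \<open>z\<close> stays outside.\<close>
      define r where "r = sqrt (max c (g / 2))"
      have m: "max c (g / 2) > 0" "max c (g / 2) < g" using False g0 gc by auto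
      have r: "r > 0" "r\<^sup>2 = max c (g / 2)" using m by (auto simp: r_def)
      have "0 \<le> (-1) * (ip y y - 2 * lc * ip u y + (lc\<^sup>2 - r\<^sup>2) * ip u u)" if "response_pair A B C D u y" for u y
      proof -
        have "c * ip u u \<le> r\<^sup>2 * ip u u" using r ip_self_nonneg[of u] by (intro mult_right_mono) auto
        then show ?thesis using Rc[OF that] by (simp add: algebra_simps)
      qed
      moreover have "r\<^sup>2 < g" using m(2) r(2) by simp
      then have "(-1) * ((cmod z)\<^sup>2 - 2 * lc * Re z + (lc\<^sup>2 - r\<^sup>2)) < 0"
        unfolding g_def by simp
      ultimately show ?thesis using r by blast
    qed
  qed
qed

section \<open>The linear matrix inequality from a dissipation inequality\<close>

text \<open>A quadratic form on a line is fixed by two of its values and the coefficient of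
  \<open>t^2\<close>, so no bilinear form has to be integrated. \<open>t = -1\<close> gives the
  parallelogram law, and a zero first argument gives homogeneity.\<close>

lemma supply_rate_interpolate:
  "supply_rate \<sigma> lc r (y + t *\<^sub>R z) (u + t *\<^sub>R v) =
    (1 - t) * supply_rate \<sigma> lc r y u + (t\<^sup>2 - t) * supply_rate \<sigma> lc r z v
    + t * supply_rate \<sigma> lc r (y + z) (u + v)"
  by (simp add: supply_rate_def inner_add inner_commute[of z y] inner_commute[of v u])
    (simp add: power2_eq_square algebra_simps)

lemma has_integral_nonneg_imp_nonneg_at_0:
  fixes \<phi> :: "real \<Rightarrow> real"
  assumes c: "continuous_on {0..} \<phi>" and i: "\<And>T. T \<ge> 0 \<Longrightarrow> 0 \<le> integral {0..T} \<phi>"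
  shows "0 \<le> \<phi> 0"
proof (rule ccontr)
  assume "\<not> 0 \<le> \<phi> 0"
  then have neg: "\<phi> 0 < 0" by simp
  obtain d where d: "d > 0" "\<And>t. t \<in> {0..} \<Longrightarrow> dist t 0 < d \<Longrightarrow> dist (\<phi> t) (\<phi> 0) < - \<phi> 0 / 2"
    using c neg unfolding continuous_on_iff by (metis atLeast_iff divide_pos_pos neg_0_less_iff_less order_refl zero_less_numeral)
  define T where "T = d / 2"
  have "integral {0..T} \<phi> \<le> integral {0..T} (\<lambda>_. \<phi> 0 / 2)"
  proof (rule integral_le)
    show "\<phi> integrable_on {0..T}"
      using continuous_on_subset[OF c, of "{0..T}"] by (intro integrable_continuous_real) auto
    fix t assume "t \<in> {0..T}"
    then have "dist (\<phi> t) (\<phi> 0) < - \<phi> 0 / 2" using d by (intro d) (auto simp: T_def dist_real_def)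
    then show "\<phi> t \<le> \<phi> 0 / 2" unfolding dist_real_def by linarith
  qed auto
  also have "\<dots> = T * (\<phi> 0 / 2)" using d by (simp add: T_def)
  also have "\<dots> < 0" using d neg by (intro mult_pos_neg) (auto simp: T_def)
  finally show False using i[of T] d by (simp add: T_def)
qed

text \<open>The value function \<open>V x0\<close>, the infimum of the supply over all trajectories starting at \<open>x0\<close>,
  is finite by controllability and obeys the parallelogram law, hence \<open>V x = x \<bullet> Q x\<close>.
  Since \<open>V\<close> decreases along a trajectory by at most the supply, \<open>P = - Q\<close> solves the inequality.\<close>

lemma neg_semidef_F_mat_of_response_inequality:
  fixes A :: "real^'m^'m" and B :: "real^'n^'m" and C :: "real^'m^'n" and D :: "real^'n^'n"
  assumes hw: "hurwitz A" and ctrl: "controllable A B"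
    and R: "\<And>u y. response_pair A B C D u y \<Longrightarrow> 0 \<le> \<sigma> * (ip y y - 2 * lc * ip u y + (lc\<^sup>2 - r\<^sup>2) * ip u u)"
  shows "\<exists>P. symmetric_mat P \<and> neg_semidef (F_mat A B C D \<sigma> lc r P)"
proof -
  define w where "w u x t = supply_rate \<sigma> lc r (C *v x t + D *v u t) (u t)"
    for u :: "real \<Rightarrow> real^'n" and x :: "real \<Rightarrow> real^'m" and t
  define J where "J u x = integral {0..} (w u x)" for u x
  define traj where "traj x0 u x \<longleftrightarrow> sq_int u \<and> lti_state A B x0 u x" for x0 u x
  have sqx: "sq_int x" if "traj x0 u x" for x0 u x
    using that lti_state_sq_int[OF hw] by (auto simp: traj_def)
  have wa: "w u x absolutely_integrable_on {0..}" if "traj x0 u x" for x0 u x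
    unfolding w_def[abs_def] using that sqx[OF that]
    by (intro supply_integral sq_int_output) (auto simp: traj_def)
  have wi: "w u x integrable_on {0..}" if "traj x0 u x" for x0 u x
    using wa[OF that] by (simp add: absolutely_integrable_on_def)
  have J0: "0 \<le> J u x" if tr: "traj 0 u x" for u x
  proof -
    have u: "sq_int u" using tr by (simp add: traj_def)
    note y = sq_int_output[OF sqx[OF tr] u, of C D]
    have "response_pair A B C D u (\<lambda>t. C *v x t + D *v u t)"
      using tr u y unfolding response_pair_def lti_response_def traj_def by blast
    from R[OF this] show ?thesis
      unfolding J_def w_def[abs_def] supply_integral(2)[OF y u] .
  qed
  have traj_interp: "traj (x0 + t *\<^sub>R z0) (\<lambda>s. u s + t *\<^sub>R v s) (\<lambda>s. x s + t *\<^sub>R z s)"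
    if "traj x0 u x" "traj z0 v z" for x0 z0 u v x z t
    using that unfolding traj_def by (auto intro!: sq_int_add sq_int_scaleR lti_state_add lti_state_scaleR)
  have J_interp: "J (\<lambda>s. u s + t *\<^sub>R v s) (\<lambda>s. x s + t *\<^sub>R z s) =
      (1 - t) * J u x + (t\<^sup>2 - t) * J v z + t * J (\<lambda>s. u s + v s) (\<lambda>s. x s + z s)"
    if 1: "traj x0 u x" and 2: "traj z0 v z" for x0 z0 u v x z t
  proof -
    have 3: "w (\<lambda>s. u s + v s) (\<lambda>s. x s + z s) integrable_on {0..}"
      using wi[OF traj_interp[OF that, of 1]] by simp
    have "w (\<lambda>s. u s + t *\<^sub>R v s) (\<lambda>s. x s + t *\<^sub>R z s) s =
       (1 - t) * w u x s + (t\<^sup>2 - t) * w v z s + t * w (\<lambda>s. u s + v s) (\<lambda>s. x s + z s) s" for s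
    proof -
      have "C *v (x s + t *\<^sub>R z s) + D *v (u s + t *\<^sub>R v s) =
          (C *v x s + D *v u s) + t *\<^sub>R (C *v z s + D *v v s)"
        by (simp add: matrix_vector_right_distrib matrix_vector_mult_scaleR scaleR_right_distrib)
      moreover have "C *v (x s + z s) + D *v (u s + v s) = (C *v x s + D *v u s) + (C *v z s + D *v v s)"
        by (simp add: matrix_vector_right_distrib)
      ultimately show ?thesis by (simp only: w_def supply_rate_interpolate)
    qed
    then have "w (\<lambda>s. u s + t *\<^sub>R v s) (\<lambda>s. x s + t *\<^sub>R z s) =
       (\<lambda>s. (1 - t) * w u x s + (t\<^sup>2 - t) * w v z s + t * w (\<lambda>s. u s + v s) (\<lambda>s. x s + z s) s)" ..
    moreover have "((\<lambda>s. (1 - t) * w u x s + (t\<^sup>2 - t) * w v z s + t * w (\<lambda>s. u s + v s) (\<lambda>s. x s + z s) s)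
        has_integral (1 - t) * J u x + (t\<^sup>2 - t) * J v z + t * J (\<lambda>s. u s + v s) (\<lambda>s. x s + z s)) {0..}"
      unfolding J_def using wi[OF 1] wi[OF 2] 3
      by (intro has_integral_add has_integral_mult_right integrable_integral)
    ultimately show ?thesis by (simp add: J_def integral_unique)
  qed
  \<comment> \<open>The first piece need not be a trajectory in the sense of \<open>traj\<close>:
    regularity on \<open>{0..T}\<close> admits constant inputs.\<close>
  have J_switch: "traj x0 (switch T u1 u2) (switch T x1 x2) \<and>
      J (switch T u1 u2) (switch T x1 x2) = integral {0..T} (w u1 x1) + J u2 x2"
    if T: "0 \<le> T" and 1: "lti_state A B x0 u1 x1" and 2: "traj (x1 T) u2 x2"
      and u1: "u1 \<in> borel_measurable (lebesgue_on {0..T})" "(\<lambda>t. (norm (u1 t))\<^sup>2) integrable_on {0..T}"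
      and w1: "w u1 x1 absolutely_integrable_on {0..T}" for T x0 u1 u2 x1 x2
  proof
    show "traj x0 (switch T u1 u2) (switch T x1 x2)"
      using 2 lti_state_switch[OF T 1] sq_int_switch[OF T u1] unfolding traj_def by blast
    have "w (switch T u1 u2) (switch T x1 x2) = switch T (w u1 x1) (w u2 x2)"
      by (auto simp: w_def switch_def fun_eq_iff)
    then show "J (switch T u1 u2) (switch T x1 x2) = integral {0..T} (w u1 x1) + J u2 x2"
      unfolding J_def using integral_switch(2)[OF T w1 wa[OF 2]] by simp
  qed
  have ex_traj: "\<exists>u x. traj x0 u x" for x0
    using ctrl unfolding controllable_def traj_def in_L2_iff_sq_int by blast
  \<comment> \<open>Preceded by a fixed trajectory from rest to \<open>x0\<close>, any trajectory
    from \<open>x0\<close> becomes one from rest, whose total supply is nonnegative. The supply of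
    the fixed part is the bound.\<close>
  have lower: "\<exists>c. \<forall>u x. traj x0 u x \<longrightarrow> c \<le> J u x" for x0
  proof -
    obtain T u1 x1 where T: "T > 0" and 1: "traj 0 u1 x1" "x1 T = x0"
      using ctrl unfolding controllable_def traj_def in_L2_iff_sq_int by meson
    have "- integral {0..T} (w u1 x1) \<le> J u x" if "traj x0 u x" for u x
    proof -
      have l: "lti_state A B 0 u1 x1" and s: "sq_int u1" using 1 by (auto simp: traj_def)
      have "w u1 x1 absolutely_integrable_on {0..T}"
        using wa[OF 1(1)] by (rule absolutely_integrable_on_subinterval) auto
      from J_switch[OF _ l _ sq_int_on_Icc[OF s] this, of u x] J0
      show ?thesis using T that 1(2) by fastforce
    qed
    then show ?thesis by blast
  qed
  define V where "V x0 = Inf {J u x | u x. traj x0 u x}" for x0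
  have V_le: "V x0 \<le> J u x" if "traj x0 u x" for x0 u x
    unfolding V_def using that lower[of x0] by (intro cInf_lower) (auto simp: bdd_below_def)
  have V_ge: "c \<le> V x0" if "\<And>u x. traj x0 u x \<Longrightarrow> c \<le> J u x" for c x0
    unfolding V_def using that ex_traj[of x0] by (intro cInf_greatest) auto
  have zero: "traj 0 (\<lambda>_. 0) (\<lambda>_. 0)" "J (\<lambda>_. 0) (\<lambda>_. 0) = 0"
    by (simp_all add: traj_def lti_state_zero J_def w_def[abs_def] supply_rate_def)
  have V0: "V 0 = 0"
    using V_ge[OF J0] V_le[OF zero(1)] zero(2) by (intro antisym) auto
  have scale_le: "V (c *\<^sub>R x0) \<le> c\<^sup>2 * J u x" if "traj x0 u x" for c x0 u x
  proof -
    have "V (c *\<^sub>R x0) \<le> J (\<lambda>s. c *\<^sub>R u s) (\<lambda>s. c *\<^sub>R x s)"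
      using V_le[OF traj_interp[OF zero(1) that, of c]] by simp
    also have "\<dots> = c\<^sup>2 * J u x"
      using J_interp[OF zero(1) that, of c] zero(2) by (simp add: algebra_simps)
    finally show ?thesis .
  qed
  have scale: "V (c *\<^sub>R x0) = c\<^sup>2 * V x0" for c x0
  proof (cases "c = 0")
    case True
    then show ?thesis by (simp add: V0)
  next
    case False
    have le: "V (a *\<^sub>R z) \<le> a\<^sup>2 * V z" if "a \<noteq> 0" for a z
    proof -
      have "V (a *\<^sub>R z) / a\<^sup>2 \<le> V z"
        using scale_le[of z _ _ a] that by (intro V_ge) (simp add: field_simps)
      then show ?thesis using that by (simp add: field_simps)
    qed
    \<comment> \<open>The reverse inequality is the same estimate for the inverse factor.\<close>
    have "V x0 \<le> (inverse c)\<^sup>2 * V (c *\<^sub>R x0)"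
      using le[of "inverse c" "c *\<^sub>R x0"] False by simp
    then have "c\<^sup>2 * V x0 \<le> V (c *\<^sub>R x0)"
      using False by (simp add: field_simps)
    then show ?thesis using le[OF False, of x0] by simp
  qed
  have par_le: "V (x0 + z0) + V (x0 - z0) \<le> 2 * V x0 + 2 * V z0" for x0 z0
  proof -
    have JJ: "V (x0 + z0) + V (x0 - z0) \<le> 2 * J u x + 2 * J v z"
      if "traj x0 u x" "traj z0 v z" for u x v z
    proof -
      have "V (x0 + z0) \<le> J (\<lambda>s. u s + v s) (\<lambda>s. x s + z s)"
        using V_le[OF traj_interp[OF that, of 1]] by simp
      moreover have "V (x0 - z0) \<le> J (\<lambda>s. u s + (-1) *\<^sub>R v s) (\<lambda>s. x s + (-1) *\<^sub>R z s)"
        using V_le[OF traj_interp[OF that, of "-1"]] by simp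
      ultimately show ?thesis using J_interp[OF that, of "-1"] by simp
    qed
    have "(V (x0 + z0) + V (x0 - z0) - 2 * J u x) / 2 \<le> V z0" if "traj x0 u x" for u x
      using JJ[OF that] by (intro V_ge) (simp add: field_simps)
    then have "(V (x0 + z0) + V (x0 - z0) - 2 * V z0) / 2 \<le> V x0"
      by (intro V_ge) (simp add: field_simps)
    then show ?thesis by simp
  qed
  have par: "V (x0 + z0) + V (x0 - z0) = 2 * V x0 + 2 * V z0" for x0 z0
  proof -
    \<comment> \<open>The inequality \<open>par_le\<close> for the sum and the difference, together
      with homogeneity for the factor 2, is its own converse.\<close>
    have "V (2 *\<^sub>R x0) + V (2 *\<^sub>R z0) \<le> 2 * V (x0 + z0) + 2 * V (x0 - z0)"
      using par_le[of "x0 + z0" "x0 - z0"] by (simp add: scaleR_2)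
    then show ?thesis using par_le[of x0 z0] scale[of 2] by simp
  qed
  have bdd: "\<exists>K. \<forall>t. \<bar>t\<bar> \<le> 1 \<longrightarrow> V (x0 + t *\<^sub>R z0) \<le> K" for x0 z0
  proof -
    obtain u x v z where tr: "traj x0 u x" "traj z0 v z" using ex_traj by metis
    define j where "j = J (\<lambda>s. u s + v s) (\<lambda>s. x s + z s)"
    have "V (x0 + t *\<^sub>R z0) \<le> 2 * \<bar>J u x\<bar> + 2 * \<bar>J v z\<bar> + \<bar>j\<bar>" if t: "\<bar>t\<bar> \<le> 1" for t
    proof -
      have "t\<^sup>2 \<le> 1" "0 \<le> t\<^sup>2" using t by (auto simp: abs_square_le_1)
      then have "\<bar>1 - t\<bar> \<le> 2" "\<bar>t\<^sup>2 - t\<bar> \<le> 2" using t by linarith+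
      then have "\<bar>(1 - t) * J u x\<bar> \<le> 2 * \<bar>J u x\<bar>" "\<bar>(t\<^sup>2 - t) * J v z\<bar> \<le> 2 * \<bar>J v z\<bar>" "\<bar>t * j\<bar> \<le> 1 * \<bar>j\<bar>"
        unfolding abs_mult using t by (intro mult_right_mono; simp)+
      moreover have "V (x0 + t *\<^sub>R z0) \<le> (1 - t) * J u x + (t\<^sup>2 - t) * J v z + t * j"
        using V_le[OF traj_interp[OF tr, of t]] J_interp[OF tr, of t] by (simp add: j_def)
      ultimately show ?thesis by (smt (verit))
    qed
    then show ?thesis by blast
  qed
  obtain Q where Q: "symmetric_mat Q" "\<And>x. V x = x \<bullet> (Q *v x)"
    using quadratic_form_of_parallelogram[OF par scale bdd] by blast
  have ineq: "0 \<le> supply_rate \<sigma> lc r (C *v x0 + D *v u0) u0 + 2 * (x0 \<bullet> (Q *v (A *v x0 + B *v u0)))" for x0 u0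
  proof -
    \<comment> \<open>With a constant input the supply is continuous in time, so an integrated
      inequality can be evaluated at time 0, where state and input are arbitrary.\<close>
    obtain x where x: "lti_state A B x0 (\<lambda>_. u0) x" using ex_constant_input_state by blast
    have x0: "x 0 = x0" using x by (rule lti_state_at_0)
    have cx: "continuous_on {0..} x"
      using x unfolding lti_state_def by (intro continuous_on_half_line_integral) blast
    have cT: "continuous_on {0..T} x" for T using cx by (rule continuous_on_subset) auto
    have Qsym: "a \<bullet> (Q *v b) = b \<bullet> (Q *v a)" for a b
      using Q(1) inner_transpose_mult[of a Q b] by (simp add: symmetric_mat_def inner_commute)
    define d where "d s = A *v x s + B *v u0" for s
    have cd: "continuous_on S d" if "continuous_on S x" for S
      unfolding d_def using linear_continuous_on_compose[OF that matrix_vector_mul_linear] by (intro continuous_intros)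
    have cQd: "continuous_on S (\<lambda>t. Q *v d t)" if "continuous_on S x" for S
      using linear_continuous_on_compose[OF cd[OF that] matrix_vector_mul_linear] .
    have cw: "continuous_on S (w (\<lambda>_. u0) x)" if "continuous_on S x" for S
      unfolding w_def[abs_def] supply_rate_def
      using linear_continuous_on_compose[OF that matrix_vector_mul_linear] by (intro continuous_intros)
    \<comment> \<open>Supply plus derivative of \<open>V\<close> along the trajectory.\<close>
    define \<phi> where "\<phi> t = w (\<lambda>_. u0) x t + 2 * (x t \<bullet> (Q *v d t))" for t
    have c\<phi>: "continuous_on S \<phi>" if "continuous_on S x" for S
      unfolding \<phi>_def using that cw[OF that] cQd[OF that] by (intro continuous_intros)
    have "0 \<le> integral {0..T} \<phi>" if T: "T \<ge> 0" for T
    proof -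
      have dabs: "d absolutely_integrable_on {0..T}"
        using cd[OF cT] by (rule absolutely_integrable_continuous_real)
      have dint: "(d has_integral (x t - x 0)) {0..t}" if "t \<ge> 0" for t
        using x that x0 unfolding lti_state_def d_def by auto
      have "((\<lambda>t. x t \<bullet> (Q *v d t) + d t \<bullet> (Q *v x t)) has_integral
          (x T \<bullet> (Q *v x T) - x 0 \<bullet> (Q *v x 0))) {0..T}"
      proof (rule has_integral_inner_by_parts[OF T])
        show "(\<lambda>t. Q *v d t) absolutely_integrable_on {0..T}"
          using cQd[OF cT] by (rule absolutely_integrable_continuous_real)
        show "((\<lambda>t. Q *v d t) has_integral (Q *v x t - Q *v x 0)) {0..t}" if "t \<ge> 0" for t
          using has_integral_linear[OF dint[OF that] bounded_linear_matrix[of Q]]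
          by (simp add: o_def matrix_vector_mult_diff_distrib)
      qed (use dint dabs in auto)
      moreover have "x t \<bullet> (Q *v d t) + d t \<bullet> (Q *v x t) = 2 * (x t \<bullet> (Q *v d t))" for t
        using Qsym[of "d t" "x t"] by simp
      ultimately have parts: "((\<lambda>t. 2 * (x t \<bullet> (Q *v d t))) has_integral (V (x T) - V x0)) {0..T}"
        by (simp add: Q(2) x0)
      have wT: "(w (\<lambda>_. u0) x has_integral integral {0..T} (w (\<lambda>_. u0) x)) {0..T}"
        using integrable_continuous_real[OF cw[OF cT]] by (rule integrable_integral)
      have "integral {0..T} \<phi> = integral {0..T} (w (\<lambda>_. u0) x) + (V (x T) - V x0)"
        unfolding \<phi>_def using has_integral_add[OF wT parts] by (rule integral_unique)
      \<comment> \<open>Dynamic programming: following the constant input up to \<open>T\<close> and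
        continuing arbitrarily is one of the competitors in the infimum at
        \<open>x0\<close>.\<close>
      moreover have "V x0 - integral {0..T} (w (\<lambda>_. u0) x) \<le> V (x T)"
      proof (rule V_ge)
        fix u2 x2 assume "traj (x T) u2 x2"
        from J_switch[OF T x this]
        have "traj x0 (switch T (\<lambda>_. u0) u2) (switch T x x2) \<and>
            J (switch T (\<lambda>_. u0) u2) (switch T x x2) = integral {0..T} (w (\<lambda>_. u0) x) + J u2 x2"
          using continuous_on_Icc_sq_int[of T "\<lambda>_. u0"] absolutely_integrable_continuous_real[OF cw[OF cT]]
          by simp
        then show "V x0 - integral {0..T} (w (\<lambda>_. u0) x) \<le> J u2 x2"
          using V_le by fastforce
      qed
      ultimately show ?thesis by simp
    qed
    from has_integral_nonneg_imp_nonneg_at_0[OF c\<phi>[OF cx] this]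
    show ?thesis by (simp add: \<phi>_def w_def d_def x0)
  qed
  define P where "P = - Q"
  have Pv: "P *v v = - (Q *v v)" for v
    by (simp add: P_def vec_eq_iff matrix_vector_mult_def sum_negf)
  have P: "symmetric_mat P"
    using Q(1) by (simp add: P_def symmetric_mat_def transpose_def vec_eq_iff)
  have "neg_semidef (F_mat A B C D \<sigma> lc r P)"
    unfolding neg_semidef_F_mat_iff[OF P] using ineq by (simp add: Pv) (smt (verit))
  then show ?thesis using P by blast
qed

theorem theorem12:
  fixes A :: "real^'m^'m" and B :: "real^'n^'m" and C :: "real^'m^'n" and D :: "real^'n^'n"
  assumes "minimal_realization A B C D"
    and "normal_system A B C D"
    and "hurwitz A"
    and "controllable A B"
  shows "closure (scaled_graph (lti_response A B C D)) =
    (\<Inter>Q\<in>Pi_set1 A B C D \<union> Pi_set2 A B C D. S_region Q)"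
proof
  show "closure (scaled_graph (lti_response A B C D)) \<subseteq>
      (\<Inter>Q\<in>Pi_set1 A B C D \<union> Pi_set2 A B C D. S_region Q)"
  proof (rule INT_greatest)
    fix Q assume "Q \<in> Pi_set1 A B C D \<union> Pi_set2 A B C D"
    then obtain \<sigma> lc r P where "Q = Pi_mat \<sigma> lc r" "symmetric_mat P" "neg_semidef (F_mat A B C D \<sigma> lc r P)"
      unfolding Pi_set1_def Pi_set2_def by blast
    then have "scaled_graph (lti_response A B C D) \<subseteq> S_region Q"
      using scaled_graph_subset[OF \<open>hurwitz A\<close>] by blast
    then show "closure (scaled_graph (lti_response A B C D)) \<subseteq> S_region Q"
      using closed_S_region by (rule closure_minimal)
  qed
  show "(\<Inter>Q\<in>Pi_set1 A B C D \<union> Pi_set2 A B C D. S_region Q) \<subseteq>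
      closure (scaled_graph (lti_response A B C D))"
  proof (rule subsetI, rule ccontr)
    fix z assume z: "z \<in> (\<Inter>Q\<in>Pi_set1 A B C D \<union> Pi_set2 A B C D. S_region Q)"
      and nz: "z \<notin> closure (scaled_graph (lti_response A B C D))"
    obtain \<sigma> lc r where \<sigma>: "\<sigma> \<in> {1, -1}" and r: "r > 0"
      and neg: "\<sigma> * ((cmod z)\<^sup>2 - 2 * lc * Re z + (lc\<^sup>2 - r\<^sup>2)) < 0"
      and R: "\<And>u y. response_pair A B C D u y \<Longrightarrow>
        0 \<le> \<sigma> * (ip y y - 2 * lc * ip u y + (lc\<^sup>2 - r\<^sup>2) * ip u u)"
      using scaled_graph_separating_circle[OF nz] by auto
    have "\<exists>P. symmetric_mat P \<and> neg_semidef (F_mat A B C D \<sigma> lc r P)"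
      using neg_semidef_F_mat_of_response_inequality[OF assms(3,4) R] .
    then have "Pi_mat \<sigma> lc r \<in> Pi_set1 A B C D \<union> Pi_set2 A B C D"
      using \<sigma> r unfolding Pi_set1_def Pi_set2_def by blast
    then have "z \<in> S_region (Pi_mat \<sigma> lc r)" using z by blast
    then show False using neg by (simp add: S_region_Pi_mat)
  qed
qed

end
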